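(* (1) Let $\underline w$ be a viscous profile corresponding to $(p,s,h)=(\underline p,0,0)$ and suppose that $$\mathrm{rank}\,\nabla_a\widetilde\Psi(\underline p,0,0,\underline a)=N+1-k,\qquad\mathrm{rank}\,\nabla_{a,p}\widetilde\Psi(\underline p,0,0,\underline a)=2N+1.$$ Then in a neighborhood $\mathcal O\subset\mathbb R^{2N}\times\mathbb R^d$ of $\underline q=(\underline p,0,0)$ there are a smooth manifold $\mathcal C_{\mathcal B}\ni\underline q$ of dimension $d+N-k$ and smooth mappings $W_\pm(z,p,s,h)$ on $\{\pm z\ge0\}\times\mathcal C_{\mathcal B}$, with $W_\pm(\cdot,\underline q)=\underline w|_{\pm z\ge0}$, such that for $(p,s,h)=(p_+,p_-,s,h)\in\mathcal C_{\mathcal B}$: $(1+|h|^2)W_\pm''=\mathcal A_d(W_\pm,s,h)W_\pm'$ on $\pm z\ge0$; $\lim_{z\to\pm\infty}W_\pm=p_\pm$; and on $z=0$ $$W_+-W_-=0,\qquad\partial_zW_+-\partial_zW_-=0,\qquad s+W_+\cdot\underline w_z-\underline w\cdot\underline w_z=0.$$ With $q=(p,s,h)\in\mathcal C_{\mathcal B}$, the function $W(z,q)$ equal to $W_+(z,q)$ for $z\ge0$ and $W_-(z,q)$ for $z\le0$ is a viscous profile associated to $q$. The manifold $\mathcal C_{\mathcal B}$ can be defined by an equation $\chi(p,s,h)=0$ for a smooth function $\chi:\mathcal O\to\mathbb R^{N+k}$ such that $\mathrm{rank}\,\chi_p(\underline p,0,0)=N+k$. (2) The same conclusions hold if the second rank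 condition is replaced by $\mathrm{rank}\,\nabla_{a,p,s}\widetilde\Psi(\underline p,0,0,\underline a)=2N+1$; the only difference is that now $\mathrm{rank}\,\chi_{p,s}(\underline p,0,0)=N+k$.
   Context: $A_0=I$; $A_1,\dots,A_d$ are $C^\infty$ maps from a connected open set $\mathcal U^*\subset\mathbb R^N$ to $\mathbb R^{N\times N}$; $\mathcal U_\pm\subset\mathcal U^*$ are connected open sets such that for $u\in\mathcal U_+\cup\mathcal U_-$, $\xi\in\mathbb R^d\setminus\{0\}$ all eigenvalues of $\sum_{j=1}^d\xi_jA_j(u)$ are real. $\mathcal A_d(u,s,h)=A_d(u)-sA_0(u)-\sum_{j<d}h_jA_j(u)$ for $(s,h)\in\mathbb R\times\mathbb R^{d-1}$. A viscous profile associated to $q=(p_+,p_-,s,h)$ is a smooth $w:\mathbb R\to\mathcal U^*$ with $(1+|h|^2)w''=\mathcal A_d(w,s,h)w'$ and $\lim_{z\to\pm\infty}w=p_\pm$. $\mathbb E_\pm(M)$ is the sum of (real) generalized eigenspaces of $M$ for eigenvalues with $\pm\mathrm{Re}\,\mu>0$. $\underline p=(\underline p_+,\underline p_-)$, $\underline p_\pm\in\mathcal U_\pm$, $A_d(\underline p_\pm)$ invertible; $\underline w$ is a viscous profile associated to $(\underline p_+,\underline p_-,0,0)$. $R_-$ is the number of negative eigenvalues of $A_d(\underline p_+)$, $L_+$ the number of positive eigenvalues of $A_d(\underline p_-)$, and $R_-+L_+=N+1-k$, $k\ge0$ an integer. Let $G_d=(1+|h|^2)^{-1}\mathcal A_d$;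 fix smooth families of linear isomorphisms $\alpha_\pm(p_\pm,s,h;\cdot):\mathbb E_\mp(G_d(\underline p_\pm,0,0))\to\mathbb E_\mp(G_d(p_\pm,s,h))$ for $(p_\pm,s,h)$ near $(\underline p_\pm,0,0)$, and let $\Pi_\mp$ be the spectral projection on $\mathbb E_\mp(G_d(p_\pm,s,h))$. There are $R,r>0$ such that for such $(p_\pm,s,h)$ and $a_\pm\in\mathbb E_\mp(G_d(\underline p_\pm,0,0))$, $|a_\pm|\le r$, the profile equation on $\pm z\ge0$ has a unique solution $\Phi_\pm(z,p_\pm,s,h,a_\pm)$ with limit $p_\pm$ at $\pm\infty$, $\Pi_\mp\partial_z\Phi_\pm(0)=\alpha_\pm(p_\pm,s,h;a_\pm)$, $\|\partial_z\Phi_\pm\|_{L^1(\pm z\ge0)}\le R$, $\|\partial_z\Phi_\pm\|_{L^\infty(\pm z\ge0)}\le R$; $\Phi_\pm$ is $C^\infty$, and the same notation is used for its maximal extension in $z$. There are $\underline z\le0$ and $\underline a=(\underline a_+,\underline a_-)$ (fixed) with $\underline w(z)=\Phi_\pm(z\pm\underline z,\underline p_\pm,0,0,\underline a_\pm)$ on $\pm z\ge0$. Set $\phi_\pm(z,p_\pm,s,h,a_\pm)=\Phi_\pm(z\pm\underline z,p_\pm,s,h,a_\pm)$ and, with $p=(p_+,p_-)$, $a=(a_+,a_-)\in\mathbb E_-(G_d(\underline p_+,0,0))\times\mathbb E_+(G_d(\underline p_-,0,0))$, $$\widetilde\Psi(p,s,h,a)=\begin{pmatrix}\phi_+-\phi_-\\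 \partial_z\phi_+-\partial_z\phi_-\\ s+\phi_+\cdot\underline w_z(0)-\underline w(0)\cdot\underline w_z(0)\end{pmatrix}\Big|_{z=0}\in\mathbb R^{2N+1},\qquad\widetilde\Psi(\underline p,0,0,\underline a)=0.$$ *)

theory Defs
  imports "HOL-Analysis.Analysis"
begin

section \<open>Smooth maps, submanifolds, ranks of partial derivatives\<close>

primrec Ck_on :: "nat \<Rightarrow> 'a::euclidean_space set \<Rightarrow> ('a \<Rightarrow> 'b::euclidean_space) \<Rightarrow> bool" where
  "Ck_on 0 U f = continuous_on U f"
| "Ck_on (Suc n) U f =
    ((\<forall>x\<in>U. f differentiable (at x)) \<and> (\<forall>v. Ck_on n U (\<lambda>x. frechet_derivative f (at x) v)))"

text \<open>Smoothness on an arbitrary set: locally the restriction of a smooth map defined on an open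
  set. On open sets this is the usual notion; on products of a closed half-line with a submanifold
  it means smooth up to the boundary.\<close>

definition smooth_on :: "'a::euclidean_space set \<Rightarrow> ('a \<Rightarrow> 'b::euclidean_space) \<Rightarrow> bool" where
  "smooth_on S f \<longleftrightarrow>
    (\<forall>x\<in>S. \<exists>U g. open U \<and> x \<in> U \<and> (\<forall>n. Ck_on n U g) \<and> (\<forall>y\<in>S \<inter> U. g y = f y))"

text \<open>Embedded submanifolds of Euclidean space, by slice charts: \<open>f\<close> is a diffeomorphism from \<open>U\<close>
  to \<open>V\<close> with inverse \<open>g\<close>.\<close>

definition smooth_submanifold :: "'a::euclidean_space set \<Rightarrow> nat \<Rightarrow> bool" where
  "smooth_submanifold M m \<longleftrightarrow>
    (\<forall>x\<in>M. \<exists>U (V :: 'a set) f g S. open U \<and> x \<in> U \<and> open V \<and> smooth_on U f \<and> smooth_on V g \<and>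
       f ` U = V \<and> g ` V = U \<and> (\<forall>y\<in>U. g (f y) = y) \<and> (\<forall>y\<in>V. f (g y) = y) \<and>
       subspace S \<and> dim S = m \<and> f ` (U \<inter> M) = V \<inter> S)"

text \<open>The partial derivative of \<open>f\<close> at \<open>x\<close> in the directions of the subspace \<open>T\<close> is the derivative
  within the affine subspace \<open>x + T\<close>; it is uniquely determined on \<open>T\<close>.\<close>

definition rank_along ::
  "('a::euclidean_space \<Rightarrow> 'b::euclidean_space) \<Rightarrow> 'a \<Rightarrow> 'a set \<Rightarrow> nat \<Rightarrow> bool" where
  "rank_along f x T m \<longleftrightarrow>
    (\<exists>D. (f has_derivative D) (at x within (\<lambda>v. x + v) ` T) \<and> dim (D ` T) = m)"


section \<open>Spectral notions\<close>

definition is_eigenvalue :: "'a::field^'n^'n \<Rightarrow> 'a \<Rightarrow> bool" where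
  "is_eigenvalue M \<mu> \<longleftrightarrow> (\<exists>v. v \<noteq> 0 \<and> M *v v = \<mu> *s v)"

definition gen_eigenspace :: "'a::field^'n^'n \<Rightarrow> 'a \<Rightarrow> ('a^'n) set" where
  "gen_eigenspace M \<mu> = {v. \<exists>m. (((*v) (M - mat \<mu>)) ^^ m) v = 0}"

definition cvec :: "real^'n \<Rightarrow> complex^'n" where
  "cvec x = (\<chi> i. complex_of_real (x $ i))"

definition cmat :: "real^'n^'n \<Rightarrow> complex^'n^'n" where
  "cmat M = (\<chi> i j. complex_of_real (M $ i $ j))"

text \<open>The real vectors in the sum of the complex generalized eigenspaces for the eigenvalues
  satisfying \<open>P\<close> (for \<open>\<mu>\<close> not an eigenvalue the generalized eigenspace is trivial).\<close>

definition spectral_space :: "(complex \<Rightarrow> bool) \<Rightarrow> real^'n^'n \<Rightarrow> (real^'n) set" where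
  "spectral_space P M = {x. cvec x \<in> vec.span (\<Union>\<mu>\<in>{\<mu>. P \<mu>}. gen_eigenspace (cmat M) \<mu>)}"

definition spectral_proj :: "(complex \<Rightarrow> bool) \<Rightarrow> real^'n^'n \<Rightarrow> real^'n \<Rightarrow> real^'n" where
  "spectral_proj P M x =
    (THE y. y \<in> spectral_space P M \<and> x - y \<in> spectral_space (\<lambda>\<mu>. \<not> P \<mu>) M)"

text \<open>Throughout, a real number \<open>\<epsilon>\<close> equal to \<open>1\<close> or \<open>-1\<close> stands for the sign in subscripts
  \<open>\<plusminus>\<close>, so that \<open>\<plusminus> Re \<mu> > 0\<close> reads \<open>\<epsilon> * Re \<mu> > 0\<close>.\<close>

definition EE :: "real \<Rightarrow> real^'n^'n \<Rightarrow> (real^'n) set" where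
  "EE \<epsilon> M = spectral_space (\<lambda>\<mu>. \<epsilon> * Re \<mu> > 0) M"

definition Proj :: "real \<Rightarrow> real^'n^'n \<Rightarrow> real^'n \<Rightarrow> real^'n" where
  "Proj \<epsilon> M = spectral_proj (\<lambda>\<mu>. \<epsilon> * Re \<mu> > 0) M"

text \<open>Number of positive (\<open>\<epsilon> = 1\<close>) or negative (\<open>\<epsilon> = -1\<close>) real eigenvalues, each counted with
  its algebraic multiplicity.\<close>

definition num_eigenvalues :: "real \<Rightarrow> real^'n^'n \<Rightarrow> nat" where
  "num_eigenvalues \<epsilon> M = (\<Sum>x | is_eigenvalue M x \<and> \<epsilon> * x > 0. dim (gen_eigenspace M x))"


section \<open>The profile equation\<close>

text \<open>The indices \<open>1, \<dots>, d\<close> are the elements of a finite type \<open>'d\<close>, the last one being \<open>l\<close>. The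
  parameters \<open>(s, h) \<in> \<real> \<times> \<real>\<^sup>d\<^sup>-\<^sup>1\<close> are packed into one vector \<open>\<sigma> :: real^'d\<close>, with \<open>s\<close> in position
  \<open>l\<close> and \<open>h\<^sub>j\<close> in position \<open>j \<noteq> l\<close>; this includes the case \<open>d = 1\<close>.
  A pair \<open>(p\<^sub>\<plusminus>, \<sigma>)\<close> has type \<open>end_param\<close>, and \<open>((p\<^sub>+, p\<^sub>-), \<sigma>)\<close> has type \<open>conn_param\<close>.\<close>

type_synonym ('n, 'd) end_param = "(real, 'n) vec \<times> (real, 'd) vec"
type_synonym ('n, 'd) conn_param = "((real, 'n) vec \<times> (real, 'n) vec) \<times> (real, 'd) vec"

definition hnorm2 :: "'d::finite \<Rightarrow> real^'d \<Rightarrow> real" where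
  "hnorm2 l \<sigma> = (\<Sum>j\<in>UNIV - {l}. (\<sigma> $ j)\<^sup>2)"

definition Ad ::
  "('d::finite \<Rightarrow> real^'n \<Rightarrow> real^'n^'n) \<Rightarrow> 'd \<Rightarrow> real^'n \<Rightarrow> real^'d \<Rightarrow> real^'n^'n" where
  "Ad A l u \<sigma> = A l u - (\<sigma> $ l) *\<^sub>R mat 1 - (\<Sum>j\<in>UNIV - {l}. (\<sigma> $ j) *\<^sub>R A j u)"

definition Gd ::
  "('d::finite \<Rightarrow> real^'n \<Rightarrow> real^'n^'n) \<Rightarrow> 'd \<Rightarrow> ('n, 'd) end_param \<Rightarrow> real^'n^'n" where
  "Gd A l q = (1 / (1 + hnorm2 l (snd q))) *\<^sub>R Ad A l (fst q) (snd q)"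

definition half_line :: "real \<Rightarrow> real set" where
  "half_line \<epsilon> = {z. 0 \<le> \<epsilon> * z}"

definition dz :: "real set \<Rightarrow> (real \<Rightarrow> 'a::real_normed_vector) \<Rightarrow> real \<Rightarrow> 'a" where
  "dz S w z = vector_derivative w (at z within S)"

definition profile_eq_on ::
  "('d::finite \<Rightarrow> real^'n \<Rightarrow> real^'n^'n) \<Rightarrow> 'd \<Rightarrow> (real^'n) set \<Rightarrow> real^'d \<Rightarrow> real set
    \<Rightarrow> (real \<Rightarrow> real^'n) \<Rightarrow> bool" where
  "profile_eq_on A l Ustar \<sigma> S w \<longleftrightarrow>
    (\<forall>z\<in>S. w z \<in> Ustar \<and> w differentiable (at z within S) \<and>
       dz S w differentiable (at z within S) \<and>
       (1 + hnorm2 l \<sigma>) *\<^sub>R dz S (dz S w) z = Ad A l (w z) \<sigma> *v dz S w z)"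

definition viscous_profile ::
  "('d::finite \<Rightarrow> real^'n \<Rightarrow> real^'n^'n) \<Rightarrow> 'd \<Rightarrow> (real^'n) set
    \<Rightarrow> ('n, 'd) conn_param \<Rightarrow> (real \<Rightarrow> real^'n) \<Rightarrow> bool" where
  "viscous_profile A l Ustar q w \<longleftrightarrow>
    smooth_on UNIV w \<and> profile_eq_on A l Ustar (snd q) UNIV w \<and>
    (w \<longlongrightarrow> fst (fst q)) at_top \<and> (w \<longlongrightarrow> snd (fst q)) at_bot"


section \<open>Profiles on half-lines\<close>

text \<open>The supremum bound is the bound in \<open>L\<^sup>\<infinity>\<close> because \<open>dz (half_line \<epsilon>) w\<close> is continuous.\<close>

definition half_profile ::
  "('d::finite \<Rightarrow> real^'n \<Rightarrow> real^'n^'n) \<Rightarrow> 'd \<Rightarrow> (real^'n) set \<Rightarrow> real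
    \<Rightarrow> (('n, 'd) end_param \<Rightarrow> real^'n \<Rightarrow> real^'n) \<Rightarrow> real
    \<Rightarrow> ('n, 'd) end_param \<Rightarrow> real^'n \<Rightarrow> (real \<Rightarrow> real^'n) \<Rightarrow> bool" where
  "half_profile A l Ustar \<epsilon> \<alpha> R q a w \<longleftrightarrow>
    profile_eq_on A l Ustar (snd q) (half_line \<epsilon>) w \<and>
    ((\<lambda>t. w (\<epsilon> * t)) \<longlongrightarrow> fst q) at_top \<and>
    Proj (-\<epsilon>) (Gd A l q) (dz (half_line \<epsilon>) w 0) = \<alpha> q a \<and>
    dz (half_line \<epsilon>) w absolutely_integrable_on half_line \<epsilon> \<and>
    integral (half_line \<epsilon>) (\<lambda>z. norm (dz (half_line \<epsilon>) w z)) \<le> R \<and>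
    (\<forall>z\<in>half_line \<epsilon>. norm (dz (half_line \<epsilon>) w z) \<le> R)"

text \<open>The largest interval to which a solution \<open>w\<close> on \<open>half_line \<epsilon>\<close> extends as a solution.\<close>

definition max_interval ::
  "('d::finite \<Rightarrow> real^'n \<Rightarrow> real^'n^'n) \<Rightarrow> 'd \<Rightarrow> (real^'n) set \<Rightarrow> real \<Rightarrow> real^'d
    \<Rightarrow> (real \<Rightarrow> real^'n) \<Rightarrow> real set" where
  "max_interval A l Ustar \<epsilon> \<sigma> w =
    \<Union>{J. is_interval J \<and> half_line \<epsilon> \<subseteq> J \<and>
        (\<exists>v. profile_eq_on A l Ustar \<sigma> J v \<and> (\<forall>z\<in>half_line \<epsilon>. v z = w z))}"

definition E_base ::
  "('d::finite \<Rightarrow> real^'n \<Rightarrow> real^'n^'n) \<Rightarrow> 'd \<Rightarrow> real \<Rightarrow> real^'n \<Rightarrow> (real^'n) set" where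
  "E_base A l \<epsilon> p0 = EE (-\<epsilon>) (Gd A l (p0, 0))"

text \<open>A smooth family of linear isomorphisms between \<open>EE (-\<epsilon>)\<close> at the base point \<open>(p0, 0)\<close> and at
  the points of \<open>V\<close>.\<close>

definition smooth_iso_family ::
  "('d::finite \<Rightarrow> real^'n \<Rightarrow> real^'n^'n) \<Rightarrow> 'd \<Rightarrow> real \<Rightarrow> real^'n \<Rightarrow> ('n, 'd) end_param set
    \<Rightarrow> (('n, 'd) end_param \<Rightarrow> real^'n \<Rightarrow> real^'n) \<Rightarrow> bool" where
  "smooth_iso_family A l \<epsilon> p0 V \<alpha> \<longleftrightarrow>
    (let E0 = E_base A l \<epsilon> p0 in
      smooth_on (V \<times> E0) (\<lambda>(q, a). \<alpha> q a) \<and>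
      (\<forall>q\<in>V. bij_betw (\<alpha> q) E0 (EE (-\<epsilon>) (Gd A l q)) \<and>
         (\<forall>a\<in>E0. \<forall>b\<in>E0. \<forall>c. \<alpha> q (c *\<^sub>R a + b) = c *\<^sub>R \<alpha> q a + \<alpha> q b)))"

text \<open>\<open>\<Phi>\<close> is the family of half-line profiles near \<open>(p0, 0)\<close>, with \<open>\<lambda>z. \<Phi> z q a\<close> extended to its
  maximal interval. It is smooth in all variables; its domain is open relative to
  \<open>\<real> \<times> V \<times> {a \<in> E0. |a| < r}\<close>, as for every flow, so that derivatives in the parameters make sense
  also at values of \<open>z\<close> outside \<open>half_line \<epsilon>\<close>.\<close>

definition half_profile_family ::
  "('d::finite \<Rightarrow> real^'n \<Rightarrow> real^'n^'n) \<Rightarrow> 'd \<Rightarrow> (real^'n) set \<Rightarrow> real \<Rightarrow> real^'n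
    \<Rightarrow> ('n, 'd) end_param set \<Rightarrow> (('n, 'd) end_param \<Rightarrow> real^'n \<Rightarrow> real^'n) \<Rightarrow> real \<Rightarrow> real
    \<Rightarrow> (real \<Rightarrow> ('n, 'd) end_param \<Rightarrow> real^'n \<Rightarrow> real^'n) \<Rightarrow> bool" where
  "half_profile_family A l Ustar \<epsilon> p0 V \<alpha> R r \<Phi> \<longleftrightarrow>
    (let E0 = E_base A l \<epsilon> p0;
         J = (\<lambda>q a. max_interval A l Ustar \<epsilon> (snd q) (\<lambda>z. \<Phi> z q a));
         D = {(z, q, a). q \<in> V \<and> a \<in> E0 \<and> norm a < r \<and> z \<in> J q a} in
      (\<forall>q\<in>V. \<forall>a\<in>E0. norm a \<le> r \<longrightarrow>
         half_profile A l Ustar \<epsilon> \<alpha> R q a (\<lambda>z. \<Phi> z q a) \<and>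
         (\<forall>v. half_profile A l Ustar \<epsilon> \<alpha> R q a v \<longrightarrow> (\<forall>z\<in>half_line \<epsilon>. v z = \<Phi> z q a)) \<and>
         profile_eq_on A l Ustar (snd q) (J q a) (\<lambda>z. \<Phi> z q a)) \<and>
      openin (top_of_set (UNIV \<times> V \<times> {a \<in> E0. norm a < r})) D \<and>
      smooth_on D (\<lambda>(z, q, a). \<Phi> z q a))"


section \<open>The map whose zeros are connections\<close>

definition phi ::
  "real \<Rightarrow> real \<Rightarrow> (real \<Rightarrow> 'q \<Rightarrow> 'a \<Rightarrow> real^'n) \<Rightarrow> real \<Rightarrow> 'q \<Rightarrow> 'a \<Rightarrow> real^'n" where
  "phi \<epsilon> zbar \<Phi> z q a = \<Phi> (z + \<epsilon> * zbar) q a"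

definition Psi ::
  "'d::finite \<Rightarrow> (real \<Rightarrow> real^'n) \<Rightarrow> real
    \<Rightarrow> (real \<Rightarrow> ('n, 'd) end_param \<Rightarrow> real^'n \<Rightarrow> real^'n)
    \<Rightarrow> (real \<Rightarrow> ('n, 'd) end_param \<Rightarrow> real^'n \<Rightarrow> real^'n)
    \<Rightarrow> ('n, 'd) conn_param \<times> ((real^'n) \<times> (real^'n)) \<Rightarrow> (real^'n) \<times> (real^'n) \<times> real" where
  "Psi l w zbar \<Phi>p \<Phi>m = (\<lambda>(((pp, pm), \<sigma>), (ap, am)).
    let fp = (\<lambda>z. phi 1 zbar \<Phi>p z (pp, \<sigma>) ap);
        fm = (\<lambda>z. phi (-1) zbar \<Phi>m z (pm, \<sigma>) am);
        wz = vector_derivative w (at 0) in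
      (fp 0 - fm 0,
       vector_derivative fp (at 0) - vector_derivative fm (at 0),
       \<sigma> $ l + fp 0 \<bullet> wz - w 0 \<bullet> wz))"

text \<open>Tangent directions in \<open>(p, s, h)\<close>-space: the variables \<open>p\<close> only, and the variables \<open>p, s\<close>.\<close>

definition dirs_p :: "('n::finite, 'd::finite) conn_param set" where
  "dirs_p = UNIV \<times> {0}"

definition dirs_ps :: "'d::finite \<Rightarrow> ('n::finite, 'd) conn_param set" where
  "dirs_ps l = UNIV \<times> span {axis l 1}"


section \<open>The family of connections\<close>

text \<open>\<open>Q\<close> is the neighbourhood of the base point, \<open>C\<close> the manifold, \<open>T\<close> the directions with respect
  to which the defining function \<open>X\<close> has full rank \<open>N + k\<close>.\<close>

definition connection_family ::
  "('d::finite \<Rightarrow> real^'n \<Rightarrow> real^'n^'n) \<Rightarrow> 'd \<Rightarrow> (real^'n) set \<Rightarrow> (real \<Rightarrow> real^'n)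
    \<Rightarrow> ('n, 'd) conn_param \<Rightarrow> nat \<Rightarrow> ('n, 'd) conn_param set
    \<Rightarrow> ('n, 'd) conn_param set \<Rightarrow> ('n, 'd) conn_param set
    \<Rightarrow> (real \<Rightarrow> ('n, 'd) conn_param \<Rightarrow> real^'n)
    \<Rightarrow> (real \<Rightarrow> ('n, 'd) conn_param \<Rightarrow> real^'n)
    \<Rightarrow> (('n, 'd) conn_param \<Rightarrow> real^'m) \<Rightarrow> bool" where
  "connection_family A l Ustar w q0 k T Q C Wp Wm X \<longleftrightarrow>
    open Q \<and> q0 \<in> Q \<and> C \<subseteq> Q \<and> q0 \<in> C \<and>
    smooth_submanifold C (CARD('d) + CARD('n) - k) \<and>
    smooth_on (half_line 1 \<times> C) (\<lambda>(z, q). Wp z q) \<and>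
    smooth_on (half_line (-1) \<times> C) (\<lambda>(z, q). Wm z q) \<and>
    (\<forall>z\<in>half_line 1. Wp z q0 = w z) \<and> (\<forall>z\<in>half_line (-1). Wm z q0 = w z) \<and>
    (\<forall>pp pm \<sigma>. ((pp, pm), \<sigma>) \<in> C \<longrightarrow>
      (let q = ((pp, pm), \<sigma>); wp = (\<lambda>z. Wp z q); wm = (\<lambda>z. Wm z q);
           wz = vector_derivative w (at 0) in
        profile_eq_on A l Ustar \<sigma> (half_line 1) wp \<and>
        profile_eq_on A l Ustar \<sigma> (half_line (-1)) wm \<and>
        (wp \<longlongrightarrow> pp) at_top \<and> (wm \<longlongrightarrow> pm) at_bot \<and>
        wp 0 - wm 0 = 0 \<and>
        dz (half_line 1) wp 0 - dz (half_line (-1)) wm 0 = 0 \<and>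
        \<sigma> $ l + wp 0 \<bullet> wz - w 0 \<bullet> wz = 0 \<and>
        viscous_profile A l Ustar q (\<lambda>z. if 0 \<le> z then wp z else wm z))) \<and>
    smooth_on Q X \<and> C = {q \<in> Q. X q = 0} \<and> rank_along X q0 T (CARD('n) + k)"

end

theory Submission
  imports Defs
begin

text \<open>
  A connection for the end states and parameters \<open>q = (p, s, h)\<close> is obtained by gluing at \<open>z = 0\<close> a
  profile on the right half-line to one on the left half-line, so it corresponds to a zero
  \<open>(q, a)\<close> of \<open>\<Psi>\<close>; the last component of \<open>\<Psi>\<close> fixes the phase. The unknown \<open>a\<close> has too few
  components to solve the \<open>2N + 1\<close> equations, and a Liapunov--Schmidt reduction splits them.

  Hyperbolicity makes all eigenvalues of \<open>A\<^sub>d\<close> at the end states real, so the space \<open>E\<close> in which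
  \<open>a\<close> varies has dimension at most \<open>R\<^sub>- + L\<^sub>+ = N + 1 - k\<close> (\<open>dim_E_base_le\<close>). As the partial
  derivative in \<open>a\<close> has exactly this rank, it is injective on \<open>E\<close>. Let \<open>M\<close> be a linear left
  inverse of it. The implicit function theorem solves \<open>M \<Psi> = 0\<close> by a smooth function \<open>a(q)\<close>
  (\<open>implicit_function_on_subspace\<close>); what remains of \<open>\<Psi> (q, a(q)) = 0\<close> are \<open>N + k\<close> equations
  \<open>\<chi>(q) = 0\<close>. Modulo the range of the derivative in \<open>a\<close>, the derivative of \<open>\<chi>\<close> is the partial
  derivative of \<open>\<Psi>\<close> in \<open>q\<close>; hence \<open>\<chi>\<close> has rank \<open>N + k\<close> along \<open>T\<close> as soon as \<open>\<Psi>\<close> is onto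
  along \<open>T \<times> E\<close> (\<open>liapunov_schmidt_reduction\<close>). This covers both rank conditions, with \<open>T\<close> the
  directions of \<open>p\<close> or of \<open>(p, s)\<close>, and the zero set of \<open>\<chi>\<close> is a manifold by
  \<open>submersion_zero_set\<close>.

  Two points about the differential equation complete the argument. The base profile is defined on
  the whole line, so the half-line profiles it consists of extend to all of \<open>\<real>\<close> and \<open>\<Psi>\<close> is defined
  and smooth near the base point (\<open>max_interval_UNIV\<close>, \<open>flow_local_extension\<close>). And the glued
  function has continuous first derivative, hence solves the equation across \<open>0\<close>, and is smooth
  by bootstrapping (\<open>glued_viscous_profile\<close>).
\<close>

section \<open>Calculus of smooth maps\<close>

lemma Ck_on_cong:
  assumes "open U" "\<And>x. x \<in> U \<Longrightarrow> f x = g x" "Ck_on n U f"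
  shows "Ck_on n U g"
  using assms(2,3)
proof (induction n arbitrary: f g)
  case 0
  then show ?case using continuous_on_cong[of U U f g] by simp
next
  case (Suc n)
  have gd: "(g has_derivative frechet_derivative f (at x)) (at x)" if "x \<in> U" for x
    using has_derivative_transform_within_open[OF _ \<open>open U\<close> that Suc.prems(1)] Suc.prems(2) that
    by (simp add: frechet_derivative_works)
  have "frechet_derivative g (at x) = frechet_derivative f (at x)" if "x \<in> U" for x
    using frechet_derivative_at[OF gd[OF that]] by simp
  moreover have "g differentiable (at x)" if "x \<in> U" for x
    using gd[OF that] differentiableI by blast
  ultimately show ?case
    using Suc.prems(2) Suc.IH[of "\<lambda>x. frechet_derivative f (at x) v" "\<lambda>x. frechet_derivative g (at x) v" for v]
    by simp
qed

lemma Ck_on_subset: "Ck_on n U f \<Longrightarrow> V \<subseteq> U \<Longrightarrow> Ck_on n V f"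
  by (induction n arbitrary: f) (auto intro: continuous_on_subset)

lemma Ck_on_SucD: "Ck_on (Suc n) U f \<Longrightarrow> Ck_on n U f"
proof (induction n arbitrary: f)
  case 0
  then show ?case
    by (auto intro!: continuous_at_imp_continuous_on differentiable_imp_continuous_within)
qed auto

lemma Ck_on_continuous: "Ck_on n U f \<Longrightarrow> continuous_on U f"
  by (induction n) (auto dest: Ck_on_SucD simp del: Ck_on.simps(2))

text \<open>The derivative may be given by any family \<open>D\<close>, so that one never has to compute
  \<open>frechet_derivative\<close> itself.\<close>

lemma Ck_on_SucI:
  assumes "open U" "\<And>x. x \<in> U \<Longrightarrow> (f has_derivative D x) (at x)" "\<And>v. Ck_on n U (\<lambda>x. D x v)"
  shows "Ck_on (Suc n) U f"
proof -
  have "frechet_derivative f (at x) = D x" if "x \<in> U" for x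
    using frechet_derivative_at[OF assms(2)[OF that]] by simp
  then have "Ck_on n U (\<lambda>x. frechet_derivative f (at x) v)" for v
    using Ck_on_cong[OF \<open>open U\<close> _ assms(3)[of v]] by simp
  moreover have "\<forall>x\<in>U. f differentiable at x" using assms(2) by (blast intro: differentiableI)
  ultimately show ?thesis by simp
qed

lemma Ck_on_SucD_derivative:
  assumes "Ck_on (Suc n) U f" "x \<in> U"
  shows "(f has_derivative frechet_derivative f (at x)) (at x)"
  using assms by (simp add: frechet_derivative_works)

lemma Ck_on_local:
  assumes "\<And>x. x \<in> U \<Longrightarrow> \<exists>V. open V \<and> x \<in> V \<and> Ck_on n V f"
  shows "Ck_on n U f"
  using assms
proof (induction n arbitrary: f)
  case 0
  then show ?case
    by (force simp: continuous_on_eq_continuous_at intro!: continuous_at_imp_continuous_on)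
next
  case (Suc n)
  have "Ck_on n U (\<lambda>x. frechet_derivative f (at x) v)" for v
    by (rule Suc.IH) (use Suc.prems in fastforce)
  then show ?case using Suc.prems by fastforce
qed

lemma Ck_on_const: "open U \<Longrightarrow> Ck_on n U (\<lambda>x. c)"
proof (induction n arbitrary: c)
  case (Suc n)
  then show ?case by (intro Ck_on_SucI[where D="\<lambda>x v. 0"]) auto
qed auto

lemma Ck_on_bounded_linear:
  assumes "bounded_linear L" "open U" "Ck_on n U f"
  shows "Ck_on n U (\<lambda>x. L (f x))"
  using assms(3)
proof (induction n arbitrary: f)
  case 0
  then show ?case using bounded_linear.continuous_on[OF assms(1)] by simp
next
  case (Suc n)
  show ?case
  proof (rule Ck_on_SucI[OF \<open>open U\<close>])
    show "((\<lambda>x. L (f x)) has_derivative (\<lambda>h. L (frechet_derivative f (at x) h))) (at x)" if "x \<in> U" for x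
      using bounded_linear.has_derivative[OF assms(1) Ck_on_SucD_derivative[OF Suc.prems that]] .
    show "Ck_on n U (\<lambda>x. L (frechet_derivative f (at x) v))" for v
      using Suc by simp
  qed
qed

lemma Ck_on_id: "open U \<Longrightarrow> Ck_on n U (\<lambda>x. x)"
  by (cases n) (auto intro!: Ck_on_SucI[where D="\<lambda>x v. v"] Ck_on_const simp del: Ck_on.simps(2))

lemma Ck_on_add:
  assumes "open U" "Ck_on n U f" "Ck_on n U g"
  shows "Ck_on n U (\<lambda>x. f x + g x)"
  using assms(2,3)
proof (induction n arbitrary: f g)
  case 0
  then show ?case by (simp add: continuous_on_add)
next
  case (Suc n)
  show ?case
  proof (rule Ck_on_SucI[OF \<open>open U\<close>])
    show "((\<lambda>x. f x + g x) has_derivative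
        (\<lambda>h. frechet_derivative f (at x) h + frechet_derivative g (at x) h)) (at x)" if "x \<in> U" for x
      using Suc.prems that by (intro has_derivative_add Ck_on_SucD_derivative)
    show "Ck_on n U (\<lambda>x. frechet_derivative f (at x) v + frechet_derivative g (at x) v)" for v
      using Suc by simp
  qed
qed

lemma Ck_on_sum:
  assumes "open U" "\<And>i. i \<in> I \<Longrightarrow> Ck_on n U (f i)"
  shows "Ck_on n U (\<lambda>x. \<Sum>i\<in>I. f i x)"
proof (cases "finite I")
  case True
  then show ?thesis using assms(2)
    by (induction I) (auto intro!: Ck_on_add Ck_on_const assms(1))
qed (simp add: Ck_on_const assms(1))

lemma Ck_on_bounded_bilinear:
  assumes B: "bounded_bilinear B" and U: "open U" and "Ck_on n U f" "Ck_on n U g"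
  shows "Ck_on n U (\<lambda>x. B (f x) (g x))"
  using assms(3,4)
proof (induction n arbitrary: f g)
  case 0
  then show ?case using bounded_bilinear.continuous_on[OF B] by simp
next
  case (Suc n)
  show ?case
  proof (rule Ck_on_SucI[OF U])
    show "((\<lambda>x. B (f x) (g x)) has_derivative
        (\<lambda>h. B (f x) (frechet_derivative g (at x) h) + B (frechet_derivative f (at x) h) (g x))) (at x)"
      if "x \<in> U" for x
      using Suc.prems that by (intro bounded_bilinear.FDERIV[OF B] Ck_on_SucD_derivative)
    show "Ck_on n U (\<lambda>x. B (f x) (frechet_derivative g (at x) v) + B (frechet_derivative f (at x) v) (g x))" for v
      using Suc.prems Ck_on_SucD[OF Suc.prems(1)] Ck_on_SucD[OF Suc.prems(2)]
      by (intro Ck_on_add U Suc.IH) auto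
  qed
qed

text \<open>The chain rule is expanded in a basis: \<open>D(g \<circ> f) v = \<Sum>\<^sub>b (Df v \<bullet> b) (Dg \<circ> f) b\<close>. Each \<open>Dg b\<close> is again
  composed with \<open>f\<close>, which the induction hypothesis covers, and sums of products are covered by
  bilinearity.\<close>

lemma Ck_on_compose:
  fixes f :: "'a::euclidean_space \<Rightarrow> 'b::euclidean_space" and g :: "'b \<Rightarrow> 'c::euclidean_space"
  assumes "open U" "open V" "Ck_on n U f" "Ck_on n V g" "f ` U \<subseteq> V"
  shows "Ck_on n U (\<lambda>x. g (f x))"
  using assms(3-5)
proof (induction n arbitrary: f g)
  case 0
  then show ?case by (simp add: continuous_on_compose2)
next
  case (Suc n)
  show ?case
  proof (rule Ck_on_SucI[OF \<open>open U\<close>])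
    fix x assume x: "x \<in> U"
    have "(g has_derivative frechet_derivative g (at (f x))) (at (f x))"
      using Suc.prems x by (intro Ck_on_SucD_derivative[OF Suc.prems(2)]) auto
    then have "((\<lambda>x. g (f x)) has_derivative (\<lambda>h. frechet_derivative g (at (f x)) (frechet_derivative f (at x) h))) (at x)"
      using has_derivative_compose[OF Ck_on_SucD_derivative[OF Suc.prems(1) x]] by blast
    moreover have "frechet_derivative g (at (f x)) (frechet_derivative f (at x) h) =
        (\<Sum>b\<in>Basis. (frechet_derivative f (at x) h \<bullet> b) *\<^sub>R frechet_derivative g (at (f x)) b)" for h
    proof -
      have "linear (frechet_derivative g (at (f x)))"
        using Suc.prems x by (intro linear_frechet_derivative) auto
      then show ?thesis
        using linear_sum[of "frechet_derivative g (at (f x))" "\<lambda>b. (frechet_derivative f (at x) h \<bullet> b) *\<^sub>R b" Basis]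
        by (simp add: euclidean_representation linear_scale)
    qed
    ultimately show "((\<lambda>x. g (f x)) has_derivative
        (\<lambda>h. \<Sum>b\<in>Basis. (frechet_derivative f (at x) h \<bullet> b) *\<^sub>R frechet_derivative g (at (f x)) b)) (at x)"
      by simp
  next
    fix v
    show "Ck_on n U (\<lambda>x. \<Sum>b\<in>Basis. (frechet_derivative f (at x) v \<bullet> b) *\<^sub>R frechet_derivative g (at (f x)) b)"
    proof (intro Ck_on_sum \<open>open U\<close> Ck_on_bounded_bilinear[OF bounded_bilinear_scaleR])
      fix b :: 'b
      show "Ck_on n U (\<lambda>x. frechet_derivative f (at x) v \<bullet> b)"
        using Suc.prems(1) by (intro Ck_on_bounded_linear[OF bounded_linear_inner_left] \<open>open U\<close>) auto
      show "Ck_on n U (\<lambda>x. frechet_derivative g (at (f x)) b)"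
        using Suc.prems Ck_on_SucD[OF Suc.prems(1)] by (intro Suc.IH[of f "\<lambda>y. frechet_derivative g (at y) b"]) auto
    qed
  qed
qed

lemma Ck_on_Pair:
  assumes "open U" "Ck_on n U f" "Ck_on n U g"
  shows "Ck_on n U (\<lambda>x. (f x, g x))"
proof -
  have "Ck_on n U (\<lambda>x. (f x, 0) + (0, g x))"
    by (intro Ck_on_add assms Ck_on_bounded_linear[of "\<lambda>y. (y, 0)"] Ck_on_bounded_linear[of "\<lambda>y. (0, y)"]
        bounded_linear_Pair bounded_linear_ident bounded_linear_zero)
  then show ?thesis by simp
qed

lemma smooth_on_open_iff:
  assumes "open U"
  shows "smooth_on U f \<longleftrightarrow> (\<forall>n. Ck_on n U f)"
proof
  assume f: "smooth_on U f"
  show "\<forall>n. Ck_on n U f"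
  proof
    fix n
    show "Ck_on n U f"
    proof (rule Ck_on_local)
      fix x assume "x \<in> U"
      then obtain V g where "open V" "x \<in> V" "\<forall>n. Ck_on n V g" "\<forall>y\<in>U \<inter> V. g y = f y"
        using f unfolding smooth_on_def by metis
      then show "\<exists>V. open V \<and> x \<in> V \<and> Ck_on n V f"
        using \<open>x \<in> U\<close> \<open>open U\<close> Ck_on_cong[of "U \<inter> V" g f n] Ck_on_subset[of n V g "U \<inter> V"] by blast
    qed
  qed
qed (use assms in \<open>auto simp: smooth_on_def\<close>)

lemma smooth_on_subset:
  assumes "smooth_on S f" "T \<subseteq> S" shows "smooth_on T f"
  unfolding smooth_on_def
proof
  fix x assume "x \<in> T"
  then obtain U g where "open U" "x \<in> U" "\<forall>n. Ck_on n U g" "\<forall>y\<in>S \<inter> U. g y = f y"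
    using assms unfolding smooth_on_def by (meson subsetD)
  then show "\<exists>U g. open U \<and> x \<in> U \<and> (\<forall>n. Ck_on n U g) \<and> (\<forall>y\<in>T \<inter> U. g y = f y)"
    using assms(2) by (intro exI[of _ U] exI[of _ g]) auto
qed

lemma smooth_on_cong:
  assumes "smooth_on S f" "\<And>x. x \<in> S \<Longrightarrow> f x = g x"
  shows "smooth_on S g"
  using assms(1) unfolding smooth_on_def by (simp add: assms(2))

text \<open>On sets that are not open, the composition of the local smooth extensions is a local smooth
  extension of the composition; it agrees with it because \<open>f\<close> maps \<open>S\<close> into \<open>T\<close>.\<close>

lemma smooth_on_compose:
  assumes f: "smooth_on S f" and g: "smooth_on T g" and sub: "f ` S \<subseteq> T"
  shows "smooth_on S (\<lambda>x. g (f x))"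
  unfolding smooth_on_def
proof
  fix x assume x: "x \<in> S"
  then obtain U f' where f': "open U" "x \<in> U" "\<forall>n. Ck_on n U f'" "\<forall>y\<in>S \<inter> U. f' y = f y"
    using f unfolding smooth_on_def by metis
  from x sub have "f x \<in> T" by auto
  then obtain V g' where g': "open V" "f x \<in> V" "\<forall>n. Ck_on n V g'" "\<forall>y\<in>T \<inter> V. g' y = g y"
    using g unfolding smooth_on_def by metis
  define W where "W = U \<inter> f' -` V"
  have "open W"
    unfolding W_def using Ck_on_continuous[of 0 U f'] f'(1,3) g'(1)
    by (intro continuous_open_preimage) blast+
  moreover have "x \<in> W" using f' g' x by (auto simp: W_def)
  moreover have "Ck_on n W (\<lambda>x. g' (f' x))" for n
  proof (rule Ck_on_compose[OF \<open>open W\<close> g'(1)])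
    show "Ck_on n W f'" using f'(3) Ck_on_subset[of n U f' W] by (auto simp: W_def)
  qed (use g'(3) in \<open>auto simp: W_def\<close>)
  moreover have "\<forall>y\<in>S \<inter> W. g' (f' y) = g (f y)"
    using f' g' sub by (auto simp: W_def)
  ultimately show "\<exists>W h. open W \<and> x \<in> W \<and> (\<forall>n. Ck_on n W h) \<and> (\<forall>y\<in>S \<inter> W. h y = g (f y))"
    by (intro exI[of _ W] exI[of _ "\<lambda>x. g' (f' x)"] conjI allI)
qed

lemma smooth_on_Pair:
  assumes f: "smooth_on S f" and g: "smooth_on S g"
  shows "smooth_on S (\<lambda>x. (f x, g x))"
  unfolding smooth_on_def
proof
  fix x assume x: "x \<in> S"
  obtain U f' where f': "open U" "x \<in> U" "\<forall>n. Ck_on n U f'" "\<forall>y\<in>S \<inter> U. f' y = f y"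
    using f x unfolding smooth_on_def by metis
  obtain V g' where g': "open V" "x \<in> V" "\<forall>n. Ck_on n V g'" "\<forall>y\<in>S \<inter> V. g' y = g y"
    using g x unfolding smooth_on_def by metis
  have "open (U \<inter> V)" "x \<in> U \<inter> V" using f' g' by auto
  moreover have "\<forall>n. Ck_on n (U \<inter> V) (\<lambda>x. (f' x, g' x))"
    using f'(3) g'(3) \<open>open (U \<inter> V)\<close> by (intro allI Ck_on_Pair) (auto intro: Ck_on_subset)
  moreover have "\<forall>y\<in>S \<inter> (U \<inter> V). (f' y, g' y) = (f y, g y)" using f' g' by auto
  ultimately show "\<exists>W h. open W \<and> x \<in> W \<and> (\<forall>n. Ck_on n W h) \<and> (\<forall>y\<in>S \<inter> W. h y = (f y, g y))"
    by (intro exI[of _ "U \<inter> V"] exI[of _ "\<lambda>x. (f' x, g' x)"] conjI) auto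
qed

lemma smooth_on_bounded_linear: "bounded_linear L \<Longrightarrow> smooth_on S L"
  using Ck_on_bounded_linear[of L UNIV _ "\<lambda>x. x"] Ck_on_id[of UNIV] smooth_on_open_iff[of UNIV L]
    smooth_on_subset[of UNIV L S] by blast

lemma smooth_on_const: "smooth_on S (\<lambda>x. c)"
  using Ck_on_const[of UNIV _ c] smooth_on_open_iff[of UNIV "\<lambda>x. c"]
    smooth_on_subset[of UNIV "\<lambda>x. c" S] by blast

lemma smooth_on_linear_compose:
  assumes "bounded_linear L" "smooth_on S f" shows "smooth_on S (\<lambda>x. L (f x))"
  using smooth_on_compose[OF assms(2) smooth_on_bounded_linear[OF assms(1)], of UNIV] by simp

lemma smooth_on_add:
  assumes "smooth_on S f" "smooth_on S g" shows "smooth_on S (\<lambda>x. f x + g x)"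
  using smooth_on_linear_compose[OF bounded_linear_add[OF bounded_linear_fst bounded_linear_snd] smooth_on_Pair[OF assms]]
  by simp

lemma smooth_on_diff:
  assumes "smooth_on S f" "smooth_on S g" shows "smooth_on S (\<lambda>x. f x - g x)"
  using smooth_on_linear_compose[OF bounded_linear_sub[OF bounded_linear_fst bounded_linear_snd] smooth_on_Pair[OF assms]]
  by simp

lemma smooth_on_has_derivative:
  assumes "open U" "smooth_on U f" "x \<in> U"
  shows "(f has_derivative frechet_derivative f (at x)) (at x)"
  using Ck_on_SucD_derivative[of 0 U f x] assms(2)[unfolded smooth_on_open_iff[OF assms(1)], rule_format, of "Suc 0"] assms(3)
  by blast

lemma smooth_on_frechet_derivative:
  assumes "open U" "smooth_on U f"
  shows "smooth_on U (\<lambda>x. frechet_derivative f (at x) v)"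
  unfolding smooth_on_open_iff[OF assms(1)]
proof
  show "Ck_on n U (\<lambda>x. frechet_derivative f (at x) v)" for n
    using assms(2)[unfolded smooth_on_open_iff[OF assms(1)], rule_format, of "Suc n"] by simp
qed

lemma smooth_on_continuous:
  assumes "open U" "smooth_on U f" shows "continuous_on U f"
  using Ck_on_continuous[of 0 U f] assms(2)[unfolded smooth_on_open_iff[OF assms(1)], rule_format, of 0]
  by blast

section \<open>The inverse function theorem for smooth maps\<close>

text \<open>A product is differentiable at a zero of one factor even if the other factor is merely
  continuous. This is what allows one to differentiate inverses before they are known to be
  differentiable.\<close>

lemma has_derivative_scaleR_vanishing:
  fixes c :: "'a::real_normed_vector \<Rightarrow> real" and s :: "'a \<Rightarrow> 'b::real_normed_vector"
  assumes c: "(c has_derivative c') (at x)" and "c x = 0" and s: "isCont s x"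
  shows "((\<lambda>y. c y *\<^sub>R s y) has_derivative (\<lambda>h. c' h *\<^sub>R s x)) (at x)"
proof -
  interpret c': bounded_linear c' using c by (rule has_derivative_bounded_linear)
  obtain K where K: "\<And>h. \<bar>c' h\<bar> \<le> norm h * K"
    using c'.bounded by auto
  have rem: "((\<lambda>y. ((c y - c' (y - x)) / norm (y - x)) *\<^sub>R s y) \<longlongrightarrow> 0 *\<^sub>R s x) (at x)"
  proof (intro tendsto_scaleR)
    show "((\<lambda>y. (c y - c' (y - x)) / norm (y - x)) \<longlongrightarrow> 0) (at x)"
      using c \<open>c x = 0\<close> by (simp add: has_derivative_within)
  qed (use s in \<open>simp add: isCont_def\<close>)
  have "((\<lambda>y. (c' (y - x) / norm (y - x)) *\<^sub>R (s y - s x)) \<longlongrightarrow> 0) (at x)"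
  proof (rule Lim_null_comparison)
    show "\<forall>\<^sub>F y in at x. norm ((c' (y - x) / norm (y - x)) *\<^sub>R (s y - s x)) \<le> K * norm (s y - s x)"
      unfolding eventually_at_filter
    proof (intro always_eventually allI impI)
      fix y assume "y \<noteq> x"
      have "\<bar>c' (y - x)\<bar> / norm (y - x) \<le> K"
        using K[of "y - x"] \<open>y \<noteq> x\<close> by (simp add: field_simps)
      then show "norm ((c' (y - x) / norm (y - x)) *\<^sub>R (s y - s x)) \<le> K * norm (s y - s x)"
        using mult_right_mono[of "\<bar>c' (y - x)\<bar> / norm (y - x)" K "norm (s y - s x)"] by simp
    qed
    show "((\<lambda>y. K * norm (s y - s x)) \<longlongrightarrow> 0) (at x)"
      using s unfolding isCont_def by (auto intro!: tendsto_eq_intros)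
  qed
  from tendsto_add[OF rem this]
  have "((\<lambda>y. (1 / norm (y - x)) *\<^sub>R (c y *\<^sub>R s y - (c x *\<^sub>R s x + c' (y - x) *\<^sub>R s x))) \<longlongrightarrow> 0 *\<^sub>R s x + 0) (at x)"
    by (rule Lim_transform_eventually)
       (auto simp: \<open>c x = 0\<close> algebra_simps divide_inverse diff_divide_distrib)
  then show ?thesis
    by (simp add: has_derivative_within bounded_linear_scaleR_const[OF c'.bounded_linear_axioms])
qed

text \<open>If \<open>|T(x) u| \<ge> B |u|\<close>, then \<open>|T(y) u| \<ge> (B/2) |u|\<close> for \<open>y\<close> near \<open>x\<close>. With \<open>u = T(x)\<inverse> v\<close> this
  bounds \<open>T(y)\<inverse> v - u\<close> by a multiple of its image under \<open>T(y)\<close>, which is \<open>T(x) u - T(y) u\<close>.\<close>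

lemma isCont_inv_operator:
  fixes T :: "'p::real_normed_vector \<Rightarrow> 'a::euclidean_space \<Rightarrow> 'a"
  assumes "open U" "x \<in> U" and lin: "\<And>y. y \<in> U \<Longrightarrow> linear (T y)" and bij: "\<And>y. y \<in> U \<Longrightarrow> bij (T y)"
    and cont: "\<And>w. isCont (\<lambda>y. T y w) x"
  shows "isCont (\<lambda>y. inv (T y) v) x"
proof -
  define u where "u = inv (T x) v"
  have Tu: "T x u = v" unfolding u_def using bij[OF \<open>x \<in> U\<close>] by (simp add: bij_is_surj surj_f_inv_f)
  obtain B where B: "B > 0" "\<And>u. B * norm u \<le> norm (T x u)"
    using linear_inj_bounded_below_pos[OF lin[OF \<open>x \<in> U\<close>] bij_is_inj[OF bij[OF \<open>x \<in> U\<close>]]] by metis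
  have "((\<lambda>y. \<Sum>b\<in>Basis. norm (T y b - T x b)) \<longlongrightarrow> (\<Sum>b\<in>(Basis::'a set). norm (T x b - T x b))) (at x)"
    using cont unfolding isCont_def by (intro tendsto_intros) auto
  then have "\<forall>\<^sub>F y in at x. (\<Sum>b\<in>Basis. norm (T y b - T x b)) < B / 2"
    using B(1) by (intro order_tendstoD) auto
  moreover have "\<forall>\<^sub>F y in at x. y \<in> U"
    using assms(1,2) by (simp add: eventually_at_topological) blast
  ultimately have "\<forall>\<^sub>F y in at x. norm (inv (T y) v - u) \<le> 2 / B * norm (T x u - T y u)"
  proof eventually_elim
    fix y assume y: "(\<Sum>b\<in>Basis. norm (T y b - T x b)) < B / 2" "y \<in> U"
    define e where "e = inv (T y) v - u"
    have near: "norm (T y e - T x e) \<le> B / 2 * norm e"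
    proof -
      interpret l: linear "\<lambda>u. T y u - T x u"
        using lin[OF y(2)] lin[OF \<open>x \<in> U\<close>] by (simp add: linear_compose_sub)
      have "T y e - T x e = (\<Sum>b\<in>Basis. (e \<bullet> b) *\<^sub>R (T y b - T x b))"
        using l.sum[of "\<lambda>b. (e \<bullet> b) *\<^sub>R b" Basis] by (simp add: euclidean_representation l.scale)
      also have "norm \<dots> \<le> (\<Sum>b\<in>Basis. norm e * norm (T y b - T x b))"
        by (rule sum_norm_le) (simp add: Basis_le_norm mult_right_mono)
      also have "\<dots> = norm e * (\<Sum>b\<in>Basis. norm (T y b - T x b))"
        by (simp add: sum_distrib_left)
      also have "\<dots> \<le> norm e * (B / 2)"
        using y(1) by (intro mult_left_mono) auto
      finally show ?thesis by (simp add: mult.commute)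
    qed
    have "T y e = T x u - T y u"
      unfolding e_def linear_diff[OF lin[OF y(2)]] Tu using bij[OF y(2)] by (simp add: bij_is_surj surj_f_inv_f)
    moreover have "norm (T x e) \<le> norm (T y e) + norm (T y e - T x e)"
      using norm_triangle_ineq[of "T y e" "T x e - T y e"] by (simp add: norm_minus_commute)
    ultimately have "B / 2 * norm e \<le> norm (T x u - T y u)"
      using B(2)[of e] near by simp
    then show "norm (inv (T y) v - u) \<le> 2 / B * norm (T x u - T y u)"
      using B(1) by (simp add: e_def field_simps)
  qed
  moreover have "((\<lambda>y. 2 / B * norm (T x u - T y u)) \<longlongrightarrow> 0) (at x)"
    using cont[of u] B(1) unfolding isCont_def by (auto intro!: tendsto_eq_intros)
  ultimately have "((\<lambda>y. inv (T y) v - u) \<longlongrightarrow> 0) (at x)"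
    by (rule Lim_null_comparison)
  then show ?thesis unfolding isCont_def u_def using LIM_zero_iff by blast
qed

text \<open>With \<open>u = T(x)\<inverse> v\<close> one has \<open>T(y)\<inverse> v = u - T(y)\<inverse> (T(y) u - T(x) u)\<close>, a sum of products of a
  differentiable factor that vanishes at \<open>x\<close> and a continuous one.\<close>

lemma has_derivative_inv_operator:
  fixes T :: "'p::real_normed_vector \<Rightarrow> 'a::euclidean_space \<Rightarrow> 'a"
  assumes "open U" "x \<in> U" and lin: "\<And>y. y \<in> U \<Longrightarrow> linear (T y)" and bij: "\<And>y. y \<in> U \<Longrightarrow> bij (T y)"
    and T': "\<And>w. ((\<lambda>y. T y w) has_derivative (T' w)) (at x)"
  shows "((\<lambda>y. inv (T y) v) has_derivative
    (\<lambda>h. - (\<Sum>b\<in>Basis. (T' (inv (T x) v) h \<bullet> b) *\<^sub>R inv (T x) b))) (at x)"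
proof -
  define u where "u = inv (T x) v"
  have Tu: "T x u = v" unfolding u_def using bij[OF \<open>x \<in> U\<close>] by (simp add: bij_is_surj surj_f_inv_f)
  have lininv: "linear (inv (T y))" if "y \<in> U" for y
    using lin[OF that] bij[OF that] by (simp add: bij_is_inj eucl.inj_linear_imp_inv_linear)
  have cont: "isCont (\<lambda>y. inv (T y) b) x" for b
    using assms(1,2) lin bij 
    by (rule isCont_inv_operator) (auto intro: has_derivative_continuous[OF T'])
  have D: "((\<lambda>y. (T y u - T x u) \<bullet> b) has_derivative (\<lambda>h. T' u h \<bullet> b)) (at x)" for b
    by (auto intro!: derivative_eq_intros T')
  have "((\<lambda>y. \<Sum>b\<in>Basis. ((T y u - T x u) \<bullet> b) *\<^sub>R inv (T y) b) has_derivative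
      (\<lambda>h. \<Sum>b\<in>Basis. (T' u h \<bullet> b) *\<^sub>R inv (T x) b)) (at x)"
    by (intro has_derivative_sum has_derivative_scaleR_vanishing cont D) auto
  then have "((\<lambda>y. u - (\<Sum>b\<in>Basis. ((T y u - T x u) \<bullet> b) *\<^sub>R inv (T y) b)) has_derivative
      (\<lambda>h. 0 - (\<Sum>b\<in>Basis. (T' u h \<bullet> b) *\<^sub>R inv (T x) b))) (at x)"
    by (intro has_derivative_diff has_derivative_const)
  then have "((\<lambda>y. inv (T y) v) has_derivative
      (\<lambda>h. 0 - (\<Sum>b\<in>Basis. (T' u h \<bullet> b) *\<^sub>R inv (T x) b))) (at x)"
  proof (rule has_derivative_transform_within_open[OF _ \<open>open U\<close> \<open>x \<in> U\<close>])
    fix y assume y: "y \<in> U"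
    have "(\<Sum>b\<in>Basis. ((T y u - T x u) \<bullet> b) *\<^sub>R inv (T y) b) = inv (T y) (T y u - T x u)"
      using linear_sum[OF lininv[OF y], of "\<lambda>b. ((T y u - T x u) \<bullet> b) *\<^sub>R b" Basis]
      by (simp add: euclidean_representation linear_scale[OF lininv[OF y]])
    also have "\<dots> = u - inv (T y) v"
      using bij[OF y] by (simp add: linear_diff[OF lininv[OF y]] Tu bij_is_inj)
    finally show "u - (\<Sum>b\<in>Basis. ((T y u - T x u) \<bullet> b) *\<^sub>R inv (T y) b) = inv (T y) v"
      by simp
  qed
  then show ?thesis by (simp add: u_def)
qed

text \<open>The derivative of \<open>y \<mapsto> T(y)\<inverse> v\<close> in direction \<open>h\<close> is \<open>- T\<inverse> (T' h) T\<inverse> v\<close>; expanded in a basis it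
  is polynomial in \<open>T'\<close> and in functions of the same form as the original one, so each
  differentiation of \<open>T\<close> yields one of the inverse.\<close>

lemma Ck_on_inv_operator:
  fixes T :: "'p::euclidean_space \<Rightarrow> 'a::euclidean_space \<Rightarrow> 'a"
  assumes U: "open U" and lin: "\<And>y. y \<in> U \<Longrightarrow> linear (T y)" and bij: "\<And>y. y \<in> U \<Longrightarrow> bij (T y)"
    and "\<And>w. Ck_on n U (\<lambda>y. T y w)"
  shows "Ck_on n U (\<lambda>y. inv (T y) v)"
  using assms(4)
proof (induction n arbitrary: v)
  case 0
  then have "isCont (\<lambda>y. inv (T y) v) x" if "x \<in> U" for x
    using that U by (intro isCont_inv_operator[OF U that lin bij]) (auto simp: continuous_on_eq_continuous_at)
  then show ?case by (simp add: continuous_at_imp_continuous_on)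
next
  case (Suc n)
  let ?T' = "\<lambda>x w. frechet_derivative (\<lambda>y. T y w) (at x)"
  have IH: "Ck_on n U (\<lambda>y. inv (T y) w)" for w
    using Suc.IH Ck_on_SucD[OF Suc.prems] by blast
  have lin': "?T' x w h = (\<Sum>b\<in>Basis. (w \<bullet> b) *\<^sub>R ?T' x b h)" if "x \<in> U" for x w h
  proof -
    have "((\<lambda>y. \<Sum>b\<in>Basis. (w \<bullet> b) *\<^sub>R T y b) has_derivative (\<lambda>h. \<Sum>b\<in>Basis. (w \<bullet> b) *\<^sub>R ?T' x b h)) (at x)"
      by (intro has_derivative_sum has_derivative_scaleR_right Ck_on_SucD_derivative[OF Suc.prems that])
    then have "((\<lambda>y. T y w) has_derivative (\<lambda>h. \<Sum>b\<in>Basis. (w \<bullet> b) *\<^sub>R ?T' x b h)) (at x)"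
    proof (rule has_derivative_transform_within_open[OF _ U that])
      fix y assume y: "y \<in> U"
      show "(\<Sum>b\<in>Basis. (w \<bullet> b) *\<^sub>R T y b) = T y w"
        using linear_sum[OF lin[OF y], of "\<lambda>b. (w \<bullet> b) *\<^sub>R b" Basis]
        by (simp add: euclidean_representation linear_scale[OF lin[OF y]])
    qed
    from frechet_derivative_at[OF this] show ?thesis by metis
  qed
  show ?case
  proof (rule Ck_on_SucI[OF U])
    fix x assume x: "x \<in> U"
    show "((\<lambda>y. inv (T y) v) has_derivative
      (\<lambda>h. - (\<Sum>b\<in>Basis. ((\<Sum>c\<in>Basis. (inv (T x) v \<bullet> c) *\<^sub>R ?T' x c h) \<bullet> b) *\<^sub>R inv (T x) b))) (at x)"
      unfolding lin'[OF x, symmetric]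
      by (intro has_derivative_inv_operator[OF U x lin bij] Ck_on_SucD_derivative[OF Suc.prems x])
  next
    fix h
    have "Ck_on n U (\<lambda>x. \<Sum>b\<in>Basis. ((\<Sum>c\<in>Basis. (inv (T x) v \<bullet> c) *\<^sub>R ?T' x c h) \<bullet> b) *\<^sub>R inv (T x) b)"
      using Suc.prems
      by (intro Ck_on_sum[OF U] Ck_on_bounded_bilinear[OF bounded_bilinear_scaleR U]
        Ck_on_bounded_linear[OF bounded_linear_inner_left U] IH) auto
    then show "Ck_on n U (\<lambda>x. - (\<Sum>b\<in>Basis. ((\<Sum>c\<in>Basis. (inv (T x) v \<bullet> c) *\<^sub>R ?T' x c h) \<bullet> b) *\<^sub>R inv (T x) b))"
      by (rule Ck_on_bounded_linear[OF bounded_linear_minus[OF bounded_linear_ident] U])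
  qed
qed

text \<open>The \<open>C\<^sup>1\<close> version provides a differentiable inverse \<open>g\<close> with \<open>g' y = (f' (g y))\<inverse>\<close>. This formula
  makes \<open>g'\<close> as smooth as \<open>g\<close>, so \<open>g\<close> is smooth by induction.\<close>

theorem smooth_inverse_function_theorem:
  fixes f :: "'a::euclidean_space \<Rightarrow> 'a"
  assumes U: "open U" "x0 \<in> U" and f: "smooth_on U f"
    and inj: "inj (frechet_derivative f (at x0))"
  obtains U' V g where "open U'" "U' \<subseteq> U" "x0 \<in> U'" "open V" "f ` U' = V" "g ` V = U'"
    "\<And>x. x \<in> U' \<Longrightarrow> g (f x) = x" "\<And>y. y \<in> V \<Longrightarrow> f (g y) = y" "smooth_on V g"
proof -
  define f' where "f' = (\<lambda>x. Blinfun (frechet_derivative f (at x)))"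
  have der: "(f has_derivative frechet_derivative f (at x)) (at x)" if "x \<in> U" for x
    using smooth_on_has_derivative[OF U(1) f that] .
  have f': "blinfun_apply (f' x) = frechet_derivative f (at x)" if "x \<in> U" for x
    unfolding f'_def using has_derivative_bounded_linear[OF der[OF that]] by (rule bounded_linear_Blinfun_apply)
  have cont: "continuous_on U f'"
  proof (rule continuous_on_blinfun_componentwise)
    fix i :: 'a
    have "continuous_on U (\<lambda>x. frechet_derivative f (at x) i)"
      using smooth_on_continuous[OF U(1) smooth_on_frechet_derivative[OF U(1) f]] .
    then show "continuous_on U (\<lambda>x. blinfun_apply (f' x) i)"
      by (rule continuous_on_cong[THEN iffD1, rotated 2]) (simp_all add: f')
  qed
  have lin0: "linear (frechet_derivative f (at x0))"
    using der[OF U(2)] has_derivative_linear by blast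
  then obtain g0 where g0: "linear g0" "g0 \<circ> frechet_derivative f (at x0) = id"
    using inj linear_injective_left_inverse by blast
  have "Blinfun g0 o\<^sub>L f' x0 = id_blinfun"
    using g0 by (intro blinfun_eqI)
      (simp add: f' U bounded_linear_Blinfun_apply linear_conv_bounded_linear[symmetric] fun_eq_iff)
  then obtain U' V g g' where *: "open U'" "U' \<subseteq> U" "x0 \<in> U'" "open V" "f x0 \<in> V" "homeomorphism U' V f g"
    "\<And>y. y \<in> V \<Longrightarrow> (g has_derivative (g' y)) (at y)"
    "\<And>y. y \<in> V \<Longrightarrow> g' y = inv (blinfun_apply (f'(g y)))"
    "\<And>y. y \<in> V \<Longrightarrow> bij (blinfun_apply (f'(g y)))"
    using inverse_function_theorem[OF U(1) _ cont U(2)] der f' by metis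
  have gV: "g y \<in> U" if "y \<in> V" for y
    using *(2,6) that by (auto simp: homeomorphism_def)
  have "Ck_on n V g" for n
  proof (induction n)
    case 0
    then show ?case using *(6) by (simp add: homeomorphism_def)
  next
    case (Suc n)
    show ?case
    proof (rule Ck_on_SucI[OF *(4) *(7)])
      fix v
      have "Ck_on n V (\<lambda>y. inv (blinfun_apply (f' (g y))) v)"
      proof (rule Ck_on_inv_operator[OF *(4) _ *(9)])
        fix w
        have "Ck_on n V (\<lambda>y. frechet_derivative f (at (g y)) w)"
          using smooth_on_frechet_derivative[OF U(1) f, of w] gV
          by (intro Ck_on_compose[OF *(4) U(1) Suc]) (auto simp: smooth_on_open_iff[OF U(1)])
        then show "Ck_on n V (\<lambda>y. blinfun_apply (f' (g y)) w)"
          by (rule Ck_on_cong[OF *(4), rotated]) (simp add: f' gV)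
      qed (auto intro: bounded_linear.linear blinfun.bounded_linear_right)
      then show "Ck_on n V (\<lambda>y. g' y v)"
        by (rule Ck_on_cong[OF *(4), rotated]) (simp add: *(8))
    qed
  qed
  then have "smooth_on V g" by (simp add: smooth_on_open_iff *(4))
  then show ?thesis
    using that[of U' V g] * by (auto simp: homeomorphism_def)
qed

section \<open>Submersions and the Liapunov--Schmidt reduction\<close>

lemma dim_kernel_plus_rank:
  fixes f :: "'a::euclidean_space \<Rightarrow> 'b::euclidean_space"
  assumes f: "linear f"
  shows "dim {x. f x = 0} + dim (range f) = DIM('a)"
proof -
  have ran: "subspace (range f)" using f by (simp add: linear_subspace_image)
  then have "span (range f) \<subseteq> f ` span UNIV" by (metis span_UNIV span_eq_iff subset_refl)
  then obtain g where g: "linear g" "\<And>y. y \<in> range f \<Longrightarrow> f (g y) = y"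
    using linear_surj_right_inverse[OF f, of "range f" UNIV] ran by (metis span_eq_iff)
  let ?K = "{x. f x = 0}" and ?I = "g ` range f"
  have K: "subspace ?K" using linear_subspace_kernel[OF f] .
  have "x \<in> {x + y |x y. x \<in> ?K \<and> y \<in> ?I}" for x
  proof -
    have "x = (x - g (f x)) + g (f x)" "x - g (f x) \<in> ?K"
      by (simp_all add: linear_diff[OF f] g(2))
    then show ?thesis by blast
  qed
  then have "{x + y |x y. x \<in> ?K \<and> y \<in> ?I} = UNIV" by blast
  moreover have "?K \<inter> ?I = {0}"
    using g linear_0[OF f] linear_0[OF g(1)] by auto
  moreover have "dim ?I = dim (range f)"
    by (rule eucl.dim_image_eq[OF g(1)]) (metis g(2) inj_on_def ran span_eq_iff)
  ultimately show ?thesis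
    using dim_sums_Int[OF K linear_subspace_image[OF g(1) ran]] by simp
qed

text \<open>If \<open>L\<close> is a right inverse of \<open>X' = X'(q0)\<close>, the map \<open>f q = q - L (X' q) + L (X q)\<close> has derivative
  the identity at \<open>q0\<close> and satisfies \<open>X' (f q) = X q\<close>. It is therefore a local diffeomorphism that
  carries the zero set of \<open>X\<close> to the kernel of \<open>X'\<close>, and this one chart serves all points of the
  zero set near \<open>q0\<close>.\<close>

theorem submersion_zero_set:
  fixes X :: "'q::euclidean_space \<Rightarrow> 'y::euclidean_space"
  assumes Q: "open Q" "q0 \<in> Q" and X: "smooth_on Q X"
    and surj: "surj (frechet_derivative X (at q0))"
  obtains Q' where "open Q'" "Q' \<subseteq> Q" "q0 \<in> Q'"
    "smooth_submanifold {q \<in> Q'. X q = 0} (DIM('q) - DIM('y))"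
proof -
  define X' where "X' = frechet_derivative X (at q0)"
  have derX: "(X has_derivative X') (at q0)"
    unfolding X'_def by (rule smooth_on_has_derivative[OF Q(1) X Q(2)])
  then have linX': "linear X'" by (rule has_derivative_linear)
  obtain L where L: "linear L" "\<And>y. X' (L y) = y"
    using linear_surjective_right_inverse[OF linX'] surj unfolding X'_def by (metis comp_apply id_apply)
  have blL: "bounded_linear L" and blX': "bounded_linear X'"
    using L(1) linX' by (auto simp: linear_conv_bounded_linear)
  define f where "f = (\<lambda>q. q - L (X' q) + L (X q))"
  have sf: "smooth_on Q f"
    unfolding f_def
    by (intro smooth_on_add smooth_on_diff smooth_on_linear_compose[OF blL] X smooth_on_bounded_linear blX'
        bounded_linear_ident)
  have "(f has_derivative (\<lambda>h. h - L (X' h) + L (X' h))) (at q0)"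
    unfolding f_def
    by (intro has_derivative_add has_derivative_diff has_derivative_ident
        bounded_linear.has_derivative[OF blL] bounded_linear.has_derivative[OF blX'] derX)
  then have "frechet_derivative f (at q0) = (\<lambda>h. h)"
    using frechet_derivative_at by force
  then have "inj (frechet_derivative f (at q0))" by simp
  from smooth_inverse_function_theorem[OF Q sf this]
  obtain Q' V g where *: "open Q'" "Q' \<subseteq> Q" "q0 \<in> Q'" "open V" "f ` Q' = V" "g ` V = Q'"
    "\<And>x. x \<in> Q' \<Longrightarrow> g (f x) = x" "\<And>y. y \<in> V \<Longrightarrow> f (g y) = y" "smooth_on V g"
    by metis
  let ?K = "{v. X' v = 0}"
  have dimK: "dim ?K = DIM('q) - DIM('y)"
    using dim_kernel_plus_rank[OF linX'] surj by (simp add: X'_def)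
  have X'f: "X' (f q) = X q" for q
    by (simp add: f_def linear_add[OF linX'] linear_diff[OF linX'] L(2))
  have "smooth_submanifold {q \<in> Q'. X q = 0} (DIM('q) - DIM('y))"
    unfolding smooth_submanifold_def
  proof
    fix x assume "x \<in> {q \<in> Q'. X q = 0}"
    then have x: "x \<in> Q'" by simp
    have img: "f ` (Q' \<inter> {q \<in> Q'. X q = 0}) = V \<inter> ?K"
    proof
      show "V \<inter> ?K \<subseteq> f ` (Q' \<inter> {q \<in> Q'. X q = 0})"
        using *(5) X'f by auto
    qed (use *(5) X'f in auto)
    show "\<exists>U (V::'q set) f g S. open U \<and> x \<in> U \<and> open V \<and> smooth_on U f \<and> smooth_on V g \<and>
       f ` U = V \<and> g ` V = U \<and> (\<forall>y\<in>U. g (f y) = y) \<and> (\<forall>y\<in>V. f (g y) = y) \<and>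
       subspace S \<and> dim S = (DIM('q) - DIM('y)) \<and> f ` (U \<inter> {q \<in> Q'. X q = 0}) = V \<inter> S"
      by (rule_tac exI[of _ Q'], rule_tac exI[of _ V], rule_tac exI[of _ f], rule_tac exI[of _ g], rule_tac exI[of _ ?K])
         (simp add: x img * dimK smooth_on_subset[OF sf *(2)] linear_subspace_kernel[OF linX'])
  qed
  then show ?thesis by (rule that[OF *(1-3)])
qed

text \<open>Let \<open>P\<close> be a linear projection onto \<open>E\<close>. The map \<open>H (q, b) = (q, b - P b + M (F (q, b)))\<close> is a local
  diffeomorphism: its derivative is injective because the second component of the image of
  \<open>(0, b)\<close> can vanish only for \<open>b \<in> E\<close>, where it equals \<open>b\<close>. A solution of
  \<open>H (q, b) = (q, 0)\<close> satisfies \<open>b = P b - M (F (q, b)) \<in> E\<close>, so \<open>P b = b\<close> and \<open>M (F (q, b)) = 0\<close>. Working in the ambient space of \<open>E\<close> avoids a coordinate system on \<open>E\<close>.\<close>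

theorem implicit_function_on_subspace:
  fixes F :: "'q::euclidean_space \<times> 'b::euclidean_space \<Rightarrow> 'y::euclidean_space"
    and M :: "'y \<Rightarrow> 'b"
  assumes \<Omega>: "open \<Omega>" "(q0, b0) \<in> \<Omega>" and F: "smooth_on \<Omega> F" "F (q0, b0) = 0"
    and D: "(F has_derivative D) (at (q0, b0))"
    and E: "subspace E" "b0 \<in> E"
    and M: "linear M" "range M \<subseteq> E" "\<And>b. b \<in> E \<Longrightarrow> M (D (0, b)) = b"
  obtains Q a where "open Q" "q0 \<in> Q" "smooth_on Q a" "a q0 = b0"
    "\<And>q. q \<in> Q \<Longrightarrow> (q, a q) \<in> \<Omega>" "\<And>q. q \<in> Q \<Longrightarrow> a q \<in> E" "\<And>q. q \<in> Q \<Longrightarrow> M (F (q, a q)) = 0"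
proof -
  obtain P where P: "linear P" "\<And>b. P b \<in> E" "\<And>b. b \<in> E \<Longrightarrow> P b = b"
    using linear_exists_left_inverse_on[OF linear_ident E(1)] by auto
  have bl: "bounded_linear P" "bounded_linear M"
    using P(1) M(1) by (auto simp: linear_conv_bounded_linear)
  define H where "H = (\<lambda>(q, b). (q, b - P b + M (F (q, b))))"
  have sH: "smooth_on \<Omega> H"
    unfolding H_def case_prod_beta
    by (intro smooth_on_Pair smooth_on_add smooth_on_diff smooth_on_linear_compose[OF bl(1)]
      smooth_on_linear_compose[OF bl(2)] smooth_on_bounded_linear[OF bounded_linear_fst]
      smooth_on_bounded_linear[OF bounded_linear_snd]) (simp add: F(1))
  have "(H has_derivative (\<lambda>v. (fst v, snd v - P (snd v) + M (D v)))) (at (q0, b0))"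
    unfolding H_def case_prod_beta prod.collapse
    by (intro has_derivative_Pair has_derivative_add has_derivative_diff
        bounded_linear.has_derivative[OF bl(1)] bounded_linear.has_derivative[OF bl(2)]
        has_derivative_fst has_derivative_snd has_derivative_ident D)
  then have H': "frechet_derivative H (at (q0, b0)) = (\<lambda>v. (fst v, snd v - P (snd v) + M (D v)))"
    using frechet_derivative_at by metis
  have "inj (frechet_derivative H (at (q0, b0)))"
  proof -
    have "linear (frechet_derivative H (at (q0, b0)))"
      using smooth_on_has_derivative[OF \<Omega>(1) sH \<Omega>(2)] by (rule has_derivative_linear)
    moreover have "v = 0" if v: "frechet_derivative H (at (q0, b0)) v = 0" for v
    proof -
      obtain b where vb: "v = (0, b)" using v H' by (cases v) (auto simp: zero_prod_def)
      have b: "b - P b + M (D (0, b)) = 0" using v vb H' by (simp add: zero_prod_def)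
      then have "b = P b - M (D (0, b))" by (simp add: algebra_simps)
      moreover have "P b - M (D (0, b)) \<in> E"
        using E(1) P(2) M(2) by (intro subspace_diff) auto
      ultimately have "b \<in> E" by simp
      then show "v = 0" using b vb P(3) M(3) by (simp add: zero_prod_def)
    qed
    ultimately show ?thesis using linear_injective_0 by blast
  qed
  from smooth_inverse_function_theorem[OF \<Omega> sH this]
  obtain U V g where *: "open U" "U \<subseteq> \<Omega>" "(q0, b0) \<in> U" "open V" "H ` U = V" "g ` V = U"
    "\<And>x. x \<in> U \<Longrightarrow> g (H x) = x" "\<And>y. y \<in> V \<Longrightarrow> H (g y) = y" "smooth_on V g"
    by metis
  have H0: "H (q0, b0) = (q0, 0)" by (simp add: H_def F(2) P(3) E(2) linear_0[OF M(1)])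
  define Q where "Q = (\<lambda>q. (q, 0::'b)) -` V"
  define a where "a = (\<lambda>q. snd (g (q, 0)))"
  have g: "g (q, 0) = (q, a q)" "a q - P (a q) + M (F (q, a q)) = 0" if "q \<in> Q" for q
  proof -
    have "H (g (q, 0)) = (q, 0)" using that *(8) by (simp add: Q_def)
    then show "g (q, 0) = (q, a q)" "a q - P (a q) + M (F (q, a q)) = 0"
      by (auto simp: H_def a_def split: prod.splits)
  qed
  have aE: "a q \<in> E" if "q \<in> Q" for q
  proof -
    have "a q = P (a q) - M (F (q, a q))" using g(2)[OF that] by (simp add: algebra_simps)
    moreover have "P (a q) - M (F (q, a q)) \<in> E"
      using E(1) P(2) M(2) by (intro subspace_diff) auto
    ultimately show ?thesis by simp
  qed
  show ?thesis
  proof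
    show "open Q" unfolding Q_def by (intro open_vimage *(4) continuous_intros)
    show "q0 \<in> Q" using *(3,5) H0 by (force simp: Q_def)
    show "smooth_on Q a"
      unfolding a_def
    proof (intro smooth_on_linear_compose[OF bounded_linear_snd] smooth_on_compose[OF _ *(9)])
      show "smooth_on Q (\<lambda>q. (q, 0::'b))"
        by (intro smooth_on_Pair smooth_on_bounded_linear[OF bounded_linear_ident] smooth_on_const)
    qed (auto simp: Q_def)
    show "a q0 = b0" using *(7)[OF *(3)] H0 by (simp add: a_def)
    show "(q, a q) \<in> \<Omega>" if "q \<in> Q" for q
      using g(1)[OF that] *(2,6) that by (force simp: Q_def)
    show "a q \<in> E" if "q \<in> Q" for q using aE[OF that] .
    show "M (F (q, a q)) = 0" if "q \<in> Q" for q
      using g(2)[OF that] P(3)[OF aE[OF that]] by simp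
  qed
qed

text \<open>The equation \<open>F (q, b) = 0\<close> with \<open>b \<in> E\<close> is split by a left inverse \<open>M\<close> of the partial derivative
  \<open>De\<close> in \<open>E\<close> into \<open>M F = 0\<close>, which determines \<open>b = a(q)\<close>, and \<open>X q = N (F (q, a q)) = 0\<close>. Here \<open>N\<close>
  is the projection \<open>y \<mapsto> y - De (M y)\<close> onto the kernel of \<open>M\<close>, followed by a linear isomorphism \<open>i\<close>
  of that kernel with \<open>\<real>\<^sup>m\<close>. Since \<open>N\<close> vanishes on the range of \<open>De\<close>, the derivative of \<open>X\<close> does not
  involve that of \<open>a\<close>, and it maps \<open>T\<close> onto \<open>\<real>\<^sup>m\<close> because \<open>D\<close> maps \<open>T \<times> E\<close> onto the whole space.\<close>

theorem liapunov_schmidt_reduction: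
  fixes F :: "'q::euclidean_space \<times> 'b::euclidean_space \<Rightarrow> 'y::euclidean_space"
  assumes \<Omega>: "open \<Omega>" "(q0, b0) \<in> \<Omega>" and F: "smooth_on \<Omega> F" "F (q0, b0) = 0"
    and D: "(F has_derivative D) (at (q0, b0))"
    and E: "subspace E" "b0 \<in> E"
    and inj: "\<forall>b\<in>E. D (0, b) = 0 \<longrightarrow> b = 0"
    and surj: "D ` (T \<times> E) = UNIV"
    and dims: "CARD('m) + dim E = DIM('y)"
  obtains Q a and X :: "'q \<Rightarrow> real^'m::finite" where
    "open Q" "q0 \<in> Q" "smooth_on Q a" "a q0 = b0" "\<And>q. q \<in> Q \<Longrightarrow> (q, a q) \<in> \<Omega>"
    "\<And>q. q \<in> Q \<Longrightarrow> a q \<in> E" "smooth_on Q X" "\<And>q. q \<in> Q \<Longrightarrow> X q = 0 \<longleftrightarrow> F (q, a q) = 0"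
    "rank_along X q0 T CARD('m)"
    "smooth_submanifold {q \<in> Q. X q = 0} (DIM('q) - CARD('m))"
proof -
  have linD: "linear D" using D by (rule has_derivative_linear)
  define De where "De = (\<lambda>b. D (0, b))"
  have linDe: "linear De"
    unfolding De_def using linear_compose[OF _ linD, of "\<lambda>b. (0, b)"]
    by (simp add: o_def linear_conv_bounded_linear bounded_linear_Pair bounded_linear_zero bounded_linear_ident)
  have "inj_on De E"
    using linear_inj_on_iff_eq_0[OF linDe E(1)] inj by (auto simp: De_def)
  then obtain M where M: "linear M" "range M \<subseteq> E" "\<And>b. b \<in> E \<Longrightarrow> M (De b) = b"
    using linear_exists_left_inverse_on[OF linDe E(1)] by metis
  obtain Q a where a: "open Q" "q0 \<in> Q" "smooth_on Q a" "a q0 = b0"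
    "\<And>q. q \<in> Q \<Longrightarrow> (q, a q) \<in> \<Omega>" "\<And>q. q \<in> Q \<Longrightarrow> a q \<in> E" "\<And>q. q \<in> Q \<Longrightarrow> M (F (q, a q)) = 0"
    using implicit_function_on_subspace[OF \<Omega> F D E M[unfolded De_def]] by metis
  have "range M = E" using M(2,3) by (metis rangeI subsetI subset_antisym)
  then have dimM: "dim {y. M y = 0} = DIM(real^'m)"
    using dim_kernel_plus_rank[OF M(1)] dims by simp
  obtain i and j :: "real^'m \<Rightarrow> 'y" where ij: "linear i" "linear j" "j ` UNIV = {y. M y = 0}"
     "\<And>y. M y = 0 \<Longrightarrow> j (i y) = y" "\<And>z. i (j z) = z"
    by (rule isometries_subspaces[OF linear_subspace_kernel[OF M(1)], of "UNIV :: (real^'m) set"])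
       (use dimM in auto)
  define N where "N = (\<lambda>y. i (y - De (M y)))"
  have blN: "bounded_linear N"
    unfolding N_def linear_conv_bounded_linear[symmetric]
    using linear_compose[OF linear_compose_sub[OF linear_ident linear_compose[OF M(1) linDe]] ij(1)]
    by (simp add: o_def)
  have N_De: "N (De b) = 0" if "b \<in> E" for b
    by (simp add: N_def M(3)[OF that] linear_0[OF ij(1)])
  have N_0: "y = 0" if "N y = 0" "M y = 0" for y
    using that ij(4)[of y] by (simp add: N_def linear_0[OF linDe] linear_0[OF ij(2)])
  have N_j: "N (j z) = z" for z
  proof -
    have "M (j z) = 0" using ij(3) by blast
    then show ?thesis by (simp add: N_def linear_0[OF linDe] ij(5))
  qed
  define X where "X = (\<lambda>q. N (F (q, a q)))"
  have sX: "smooth_on Q X"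
    unfolding X_def
  proof (intro smooth_on_linear_compose[OF blN] smooth_on_compose[OF _ F(1)])
    show "smooth_on Q (\<lambda>q. (q, a q))"
      by (intro smooth_on_Pair smooth_on_bounded_linear[OF bounded_linear_ident] a(3))
  qed (use a(5) in auto)
  have X0: "X q = 0 \<longleftrightarrow> F (q, a q) = 0" if "q \<in> Q" for q
  proof
    show "X q = 0 \<Longrightarrow> F (q, a q) = 0" using N_0[OF _ a(7)[OF that]] by (simp add: X_def)
  qed (simp add: X_def linear_0[OF bounded_linear.linear[OF blN]])
  obtain P where P: "linear P" "\<And>b. P b \<in> E" "\<And>b. b \<in> E \<Longrightarrow> P b = b"
    using linear_exists_left_inverse_on[OF linear_ident E(1)] by auto
  \<comment> \<open>The derivative of \<open>a\<close> has to take values in \<open>E\<close>. Writing \<open>a = P \<circ> a\<close> makes this evident.\<close>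
  define a' where "a' = (\<lambda>h. P (frechet_derivative a (at q0) h))"
  have "((\<lambda>q. P (a q)) has_derivative a') (at q0)"
    unfolding a'_def using P(1)
    by (simp add: linear_conv_bounded_linear bounded_linear.has_derivative[OF _ smooth_on_has_derivative[OF a(1,3,2)]])
  then have a': "(a has_derivative a') (at q0)"
    by (rule has_derivative_transform_within_open[OF _ a(1,2)]) (simp add: P(3) a(6))
  have D': "(F has_derivative D) (at (q0, a q0))" using D a(4) by simp
  have "(X has_derivative (\<lambda>h. N (D (h, a' h)))) (at q0)"
    unfolding X_def
    using has_derivative_compose[OF has_derivative_Pair[OF has_derivative_ident a'] D']
    by (intro bounded_linear.has_derivative[OF blN])
  moreover have "N (D (h, a' h)) = N (D (h, b))" if "b \<in> E" for h b
  proof -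
    have "D (h, a' h) = D (h, b) + De (a' h - b)"
      unfolding De_def linear_add[OF linD, symmetric] by simp
    moreover have "a' h - b \<in> E" using that E(1) P(2) by (auto simp: a'_def intro: subspace_diff)
    ultimately show ?thesis using N_De by (simp add: linear_add[OF bounded_linear.linear[OF blN]])
  qed
  ultimately obtain X' where X': "(X has_derivative X') (at q0)" "\<And>h b. b \<in> E \<Longrightarrow> X' h = N (D (h, b))"
    by blast
  have X'T: "X' ` T = UNIV"
  proof -
    have "z \<in> X' ` T" for z
    proof -
      have "j z \<in> D ` (T \<times> E)" using surj by simp
      then obtain t b where "t \<in> T" "b \<in> E" "j z = D (t, b)" by blast
      then show ?thesis using X'(2)[of b t] N_j[of z] by (metis imageI)
    qed
    then show ?thesis by blast
  qed
  have "surj (frechet_derivative X (at q0))"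
    using X'T frechet_derivative_at[OF X'(1)] by (metis UNIV_I subsetI image_mono subset_antisym top_greatest)
  from submersion_zero_set[OF a(1,2) sX this] obtain Q' where
    Q': "open Q'" "Q' \<subseteq> Q" "q0 \<in> Q'" "smooth_submanifold {q \<in> Q'. X q = 0} (DIM('q) - CARD('m))"
    by auto
  have "rank_along X q0 T CARD('m)"
    unfolding rank_along_def using has_derivative_at_withinI[OF X'(1)] X'T by (intro exI[of _ X']) simp
  then show ?thesis
    using Q' a X0 smooth_on_subset[OF a(3) Q'(2)] smooth_on_subset[OF sX Q'(2)]
    by (intro that[of Q' a X]) auto
qed

section \<open>Dimension of the spectral spaces at the end states\<close>

lemma gen_eigenspace_nontrivial:
  fixes M :: "'a::field^'n^'n"
  assumes "v \<in> gen_eigenspace M \<mu>" "v \<noteq> 0"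
  shows "is_eigenvalue M \<mu>"
proof -
  obtain m where "(((*v) (M - mat \<mu>)) ^^ m) v = 0"
    using assms(1) unfolding gen_eigenspace_def by blast
  then have "\<exists>u. u \<noteq> 0 \<and> (M - mat \<mu>) *v u = 0"
    using assms(2) by (induction m) auto
  then obtain u where u: "u \<noteq> 0" "(M - mat \<mu>) *v u = 0" by blast
  have "mat \<mu> *v u = \<mu> *s u"
    by (simp add: vec_eq_iff matrix_vector_mult_def mat_def if_distrib[where f="\<lambda>x. x * _"] sum.delta cong: if_cong)
  then show ?thesis
    using u unfolding is_eigenvalue_def by (auto simp: matrix_vector_mult_diff_rdistrib)
qed

text \<open>Applying \<open>M - y\<close> to a linear relation removes the eigenvector for \<open>y\<close> and multiplies the other
  coefficients by the nonzero numbers \<open>x - y\<close>.\<close>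

lemma eigenvectors_independent:
  fixes M :: "real^'n^'n"
  assumes "finite F" "\<And>x. x \<in> F \<Longrightarrow> v x \<noteq> 0 \<and> M *v v x = x *s v x"
    and "(\<Sum>x\<in>F. c x *\<^sub>R v x) = 0" "x \<in> F"
  shows "c x = 0"
  using assms
proof (induction F arbitrary: c x rule: finite_induct)
  case (insert y F)
  have sum0: "c y *\<^sub>R v y + (\<Sum>x\<in>F. c x *\<^sub>R v x) = 0"
    using insert by simp
  have "0 = M *v (c y *\<^sub>R v y + (\<Sum>x\<in>F. c x *\<^sub>R v x)) - y *\<^sub>R (c y *\<^sub>R v y + (\<Sum>x\<in>F. c x *\<^sub>R v x))"
    unfolding sum0 by simp
  also have "\<dots> = (\<Sum>x\<in>F. (c x * (x - y)) *\<^sub>R v x)"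
  proof -
    have "M *v (\<Sum>x\<in>F. c x *\<^sub>R v x) = (\<Sum>x\<in>F. (c x * x) *\<^sub>R v x)"
      using insert.prems(1) by (simp add: linear_sum[OF matrix_vector_mul_linear] matrix_vector_mult_scaleR scalar_mult_eq_scaleR)
    moreover have "M *v v y = y *\<^sub>R v y"
      using insert.prems(1)[of y] by (simp add: scalar_mult_eq_scaleR)
    ultimately show ?thesis
      by (simp add: matrix_vector_right_distrib matrix_vector_mult_scaleR scaleR_sum_right
          scaleR_right_distrib sum_subtractf algebra_simps)
  qed
  finally have "c x * (x - y) = 0" if "x \<in> F" for x
    using insert.IH[of "\<lambda>x. c x * (x - y)" x] insert.prems(1) that by simp
  then have F: "c x = 0" if "x \<in> F" for x
    using that insert.hyps(2) by fastforce
  then have "c y *\<^sub>R v y = 0" using sum0 by simp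
  then have "c y = 0" using insert.prems(1)[of y] by simp
  then show ?case using F insert.prems(3) by auto
qed simp

text \<open>There are at most as many independent eigenvectors as dimensions. Finiteness matters because
  \<open>num_eigenvalues\<close> is a sum over eigenvalues, which would be \<open>0\<close> on an infinite set.\<close>

lemma finite_eigenvalues:
  fixes M :: "real^'n^'n"
  shows "finite {x. is_eigenvalue M x}"
proof (rule ccontr)
  assume "infinite {x. is_eigenvalue M x}"
  then obtain F where F: "finite F" "card F = Suc CARD('n)" "F \<subseteq> {x. is_eigenvalue M x}"
    using infinite_arbitrarily_large by blast
  obtain v where v: "\<And>x. x \<in> F \<Longrightarrow> v x \<noteq> 0 \<and> M *v v x = x *s v x"
    using F(3) unfolding is_eigenvalue_def subset_iff mem_Collect_eq by metis
  have inj: "inj_on v F"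
    using v by (auto simp: inj_on_def) (metis vector_mul_rcancel)
  have "independent (v ` F)"
    unfolding independent_explicit
  proof (intro conjI allI impI ballI)
    fix c u assume "(\<Sum>w\<in>v ` F. c w *\<^sub>R w) = 0" "u \<in> v ` F"
    then show "c u = 0"
      using eigenvectors_independent[OF F(1) v, of "\<lambda>x. c (v x)"] by (auto simp: sum.reindex[OF inj])
  qed (use F in simp)
  then have "card (v ` F) \<le> CARD('n)" using independent_bound[of "v ` F"] by simp
  then show False using F(2) card_image[OF inj] by simp
qed

definition re_vec :: "complex^'n \<Rightarrow> real^'n" where "re_vec v = (\<chi> i. Re (v $ i))"

definition im_vec :: "complex^'n \<Rightarrow> real^'n" where "im_vec v = (\<chi> i. Im (v $ i))"

lemma re_im_vec_0 [simp]: "re_vec 0 = 0" "im_vec 0 = 0"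
  by (simp_all add: re_vec_def im_vec_def vec_eq_iff)

lemma re_im_cmat_power:
  "re_vec ((((*v) (cmat N)) ^^ m) v) = (((*v) N) ^^ m) (re_vec v)"
  "im_vec ((((*v) (cmat N)) ^^ m) v) = (((*v) N) ^^ m) (im_vec v)"
proof -
  have "re_vec (cmat N *v v) = N *v re_vec v" "im_vec (cmat N *v v) = N *v im_vec v" for v
    by (simp_all add: re_vec_def im_vec_def cmat_def matrix_vector_mult_def vec_eq_iff Re_sum Im_sum)
  then show "re_vec ((((*v) (cmat N)) ^^ m) v) = (((*v) N) ^^ m) (re_vec v)"
    "im_vec ((((*v) (cmat N)) ^^ m) v) = (((*v) N) ^^ m) (im_vec v)"
    by (induction m) simp_all
qed

lemma re_im_gen_eigenspace:
  assumes "v \<in> gen_eigenspace (cmat M) (complex_of_real t)"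
  shows "re_vec v \<in> gen_eigenspace M t" "im_vec v \<in> gen_eigenspace M t"
proof -
  have "cmat M - mat (complex_of_real t) = cmat (M - mat t)"
    by (simp add: vec_eq_iff cmat_def mat_def)
  then obtain m where m: "(((*v) (cmat (M - mat t))) ^^ m) v = 0"
    using assms by (auto simp: gen_eigenspace_def)
  then show "re_vec v \<in> gen_eigenspace M t" "im_vec v \<in> gen_eigenspace M t"
    unfolding gen_eigenspace_def using m re_im_cmat_power[of m "M - mat t" v] by auto
qed

text \<open>Taking real or imaginary parts commutes with a real matrix, hence maps complex generalized
  eigenvectors for a real eigenvalue to real ones for the same eigenvalue. Applied to a complex
  combination that represents a real vector, which is its own real part, this gives a real one.\<close>

lemma EE_subset_span:
  fixes M :: "real^'n^'n"
  assumes real: "\<And>\<mu>. is_eigenvalue (cmat M) \<mu> \<Longrightarrow> \<mu> \<in> \<real>"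
  shows "EE \<epsilon> M \<subseteq> span (\<Union>x\<in>{x. is_eigenvalue M x \<and> \<epsilon> * x > 0}. gen_eigenspace M x)"
    (is "_ \<subseteq> span ?S")
proof
  fix x assume "x \<in> EE \<epsilon> M"
  then have x: "cvec x \<in> vec.span (\<Union>\<mu>\<in>{\<mu>. \<epsilon> * Re \<mu> > 0}. gen_eigenspace (cmat M) \<mu>)"
    by (simp add: EE_def spectral_space_def)
  have "re_vec (cvec x) \<in> span ?S \<and> im_vec (cvec x) \<in> span ?S"
    using x
  proof (induction rule: vec.span_induct_alt)
    case base
    show ?case by (simp add: span_zero)
  next
    case (step c v y)
    then obtain \<mu> where \<mu>: "\<epsilon> * Re \<mu> > 0" "v \<in> gen_eigenspace (cmat M) \<mu>" by blast
    have v: "re_vec v \<in> span ?S \<and> im_vec v \<in> span ?S"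
    proof (cases "v = 0")
      case True
      then show ?thesis by (simp add: span_zero)
    next
      case False
      then obtain t where t: "\<mu> = complex_of_real t"
        using real gen_eigenspace_nontrivial[OF \<mu>(2)] by (auto elim: Reals_cases)
      have "u \<in> span ?S" if "u \<in> gen_eigenspace M t" for u
      proof (cases "u = 0")
        case False
        then have "is_eigenvalue M t" using gen_eigenspace_nontrivial that by blast
        then show ?thesis using that \<mu>(1) t by (intro span_base) auto
      qed (simp add: span_zero)
      then show ?thesis using re_im_gen_eigenspace[of v M t] \<mu>(2) t by blast
    qed
    have "re_vec (c *s v + y) = Re c *\<^sub>R re_vec v - Im c *\<^sub>R im_vec v + re_vec y"
      "im_vec (c *s v + y) = Re c *\<^sub>R im_vec v + Im c *\<^sub>R re_vec v + im_vec y"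
      by (simp_all add: re_vec_def im_vec_def vec_eq_iff)
    then show ?case using v step by (auto intro!: span_add span_diff span_scale)
  qed
  moreover have "re_vec (cvec x) = x" by (simp add: re_vec_def cvec_def vec_eq_iff)
  ultimately show "x \<in> span ?S" by simp
qed

lemma dim_EE_le:
  fixes M :: "real^'n^'n"
  assumes real: "\<And>\<mu>. is_eigenvalue (cmat M) \<mu> \<Longrightarrow> \<mu> \<in> \<real>"
  shows "dim (EE \<epsilon> M) \<le> num_eigenvalues \<epsilon> M"
proof -
  let ?L = "{x. is_eigenvalue M x \<and> \<epsilon> * x > 0}"
  have fin: "finite ?L" using finite_eigenvalues[of M] by (rule finite_subset[rotated]) auto
  have "\<exists>B. finite B \<and> V \<subseteq> span B \<and> card B = dim V" for V :: "(real^'n) set"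
    using basis_exists[of V] finiteI_independent by metis
  then obtain B where B: "\<And>V :: (real^'n) set. finite (B V) \<and> V \<subseteq> span (B V) \<and> card (B V) = dim V"
    by metis
  let ?W = "\<Union>x\<in>?L. B (gen_eigenspace M x)"
  have "(\<Union>x\<in>?L. gen_eigenspace M x) \<subseteq> span ?W"
  proof
    fix u assume "u \<in> (\<Union>x\<in>?L. gen_eigenspace M x)"
    then obtain x where x: "x \<in> ?L" "u \<in> gen_eigenspace M x" by blast
    then have "u \<in> span (B (gen_eigenspace M x))" using B by blast
    then show "u \<in> span ?W" using span_mono[of "B (gen_eigenspace M x)" ?W] x(1) by blast
  qed
  then have "EE \<epsilon> M \<subseteq> span ?W"
    using EE_subset_span[where M=M and \<epsilon>=\<epsilon>, OF real] span_minimal[OF _ subspace_span] by (meson order_trans)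
  then have "dim (EE \<epsilon> M) \<le> card ?W" using fin B by (intro dim_le_card) auto
  also have "\<dots> \<le> (\<Sum>x\<in>?L. card (B (gen_eigenspace M x)))" by (rule card_UN_le[OF fin])
  also have "\<dots> = num_eigenvalues \<epsilon> M" using B by (simp add: num_eigenvalues_def)
  finally show ?thesis .
qed

lemma subspace_EE:
  fixes M :: "real^'n^'n"
  shows "subspace (EE \<epsilon> M)"
proof -
  have "cvec (0 :: real^'n) = 0" "cvec (x + y) = cvec x + cvec y" "cvec (c *\<^sub>R x) = complex_of_real c *s cvec x" for x y :: "real^'n" and c
    by (simp_all add: cvec_def vec_eq_iff)
  then show ?thesis
    by (simp add: EE_def spectral_space_def subspace_def vec.span_zero vec.span_add vec.span_scale)
qed

lemma E_base_eq: "E_base A l \<epsilon> p0 = EE (-\<epsilon>) (A l p0)"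
  by (simp add: E_base_def Gd_def Ad_def hnorm2_def)

text \<open>Hyperbolicity is applied to the coordinate direction \<open>\<xi> = axis l 1\<close>, for which the symbol is the
  matrix \<open>A\<^sub>d\<close> itself.\<close>

lemma dim_E_base_le:
  fixes A :: "'d::finite \<Rightarrow> real^'n \<Rightarrow> real^'n^'n"
  assumes "\<And>\<xi> \<mu>. \<xi> \<noteq> 0 \<Longrightarrow> is_eigenvalue (cmat (\<Sum>j\<in>UNIV. (\<xi> $ j) *\<^sub>R A j u)) \<mu> \<Longrightarrow> \<mu> \<in> \<real>"
  shows "dim (E_base A l \<epsilon> u) \<le> num_eigenvalues (-\<epsilon>) (A l u)"
  unfolding E_base_eq
proof (rule dim_EE_le)
  fix \<mu> assume \<mu>: "is_eigenvalue (cmat (A l u)) \<mu>"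
  have "(\<Sum>j\<in>UNIV. (axis l (1::real) $ j) *\<^sub>R A j u) = A l u"
    by (simp add: axis_def if_distrib[where f="\<lambda>x. x *\<^sub>R _"] sum.delta cong: if_cong)
  then show "\<mu> \<in> \<real>" using assms[of "axis l 1" \<mu>] \<mu> by (simp add: axis_eq_0_iff)
qed

section \<open>Ranks of derivatives along subspaces\<close>

text \<open>Let \<open>P\<close> project onto \<open>E\<close>. The kernel of \<open>P\<close> is contained in that of \<open>f \<circ> P\<close>, and rank-nullity for both
  maps shows that the kernels coincide.\<close>

lemma kernel_trivial_of_dim_image:
  fixes f :: "'a::euclidean_space \<Rightarrow> 'b::euclidean_space"
  assumes f: "linear f" and E: "subspace E" and dim: "dim E \<le> dim (f ` E)"
    and b: "b \<in> E" "f b = 0"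
  shows "b = 0"
proof -
  obtain P where P: "linear P" "range P \<subseteq> E" "\<And>b. b \<in> E \<Longrightarrow> P b = b"
    using linear_exists_left_inverse_on[OF linear_ident E] by auto
  have "range P = E" using P(2,3) by (metis rangeI subsetI subset_antisym)
  moreover have "range (f \<circ> P) = f ` range P" by (rule image_comp[symmetric])
  ultimately have "dim {x. (f \<circ> P) x = 0} \<le> dim {x. P x = 0}"
    using dim_kernel_plus_rank[OF P(1)] dim_kernel_plus_rank[OF linear_compose[OF P(1) f]] dim
    unfolding \<open>range P = E\<close> by simp
  moreover have "{x. P x = 0} \<subseteq> {x. (f \<circ> P) x = 0}" using linear_0[OF f] by auto
  ultimately have "{x. P x = 0} = {x. (f \<circ> P) x = 0}"
    by (intro subspace_dim_equal linear_subspace_kernel P(1) linear_compose f)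
  moreover have "b \<in> {x. (f \<circ> P) x = 0}" using b P(3) by simp
  ultimately have "P b = 0" by blast
  then show ?thesis using P(3)[OF b(1)] by simp
qed

text \<open>The derivative is determined on \<open>T\<close> by its restrictions to the lines \<open>s \<mapsto> x + s t\<close>.\<close>

lemma has_derivative_within_subspace_unique:
  fixes f :: "'a::real_normed_vector \<Rightarrow> 'b::real_normed_vector"
  assumes T: "subspace T" and D: "(f has_derivative D) (at x within (\<lambda>v. x + v) ` T)"
    "(f has_derivative D') (at x within (\<lambda>v. x + v) ` T)" and t: "t \<in> T"
  shows "D t = D' t"
proof -
  have "((\<lambda>s::real. f (x + s *\<^sub>R t)) has_derivative (\<lambda>s. G (s *\<^sub>R t))) (at 0)"
    if G: "(f has_derivative G) (at x within (\<lambda>v. x + v) ` T)" for G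
  proof -
    have "((\<lambda>s::real. x + s *\<^sub>R t) has_derivative (\<lambda>s. s *\<^sub>R t)) (at 0)"
      by (auto intro!: derivative_eq_intros)
    moreover have "(f has_derivative G) (at (x + 0 *\<^sub>R t) within range (\<lambda>s::real. x + s *\<^sub>R t))"
      using T t by (auto intro!: has_derivative_subset[OF G] subspace_scale)
    ultimately show ?thesis by (rule has_derivative_in_compose)
  qed
  from has_derivative_unique[OF this[OF D(1)] this[OF D(2)]]
  show ?thesis by (auto dest: fun_cong[of _ _ 1])
qed

text \<open>The rank of \<open>f\<close> along \<open>S\<close> can be computed from any differentiable \<open>g\<close> that agrees with \<open>f\<close> on
  \<open>x + S\<close> near \<open>x\<close>. It is applied to a smooth extension of \<open>Psi\<close> off the affine space on which
  \<open>Psi\<close> is meaningful.\<close>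

lemma rank_along_local:
  assumes rank: "rank_along f x S m" and S: "subspace S" and g: "(g has_derivative D) (at x)"
    and N: "open N" "x \<in> N" and eq: "\<And>v. v \<in> S \<Longrightarrow> x + v \<in> N \<Longrightarrow> f (x + v) = g (x + v)"
  shows "dim (D ` S) = m"
proof -
  obtain D0 where D0: "(f has_derivative D0) (at x within (\<lambda>v. x + v) ` S)" "dim (D0 ` S) = m"
    using rank unfolding rank_along_def by blast
  obtain e where e: "e > 0" "ball x e \<subseteq> N" using N open_contains_ball by blast
  have "0 \<in> S" using S by (simp add: subspace_0)
  have "(f has_derivative D) (at x within (\<lambda>v. x + v) ` S)"
  proof (rule has_derivative_transform_within[OF has_derivative_at_withinI[OF g] e(1)])
    show "x \<in> (\<lambda>v. x + v) ` S" using \<open>0 \<in> S\<close> by force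
    fix y assume "y \<in> (\<lambda>v. x + v) ` S" "dist y x < e"
    then show "g y = f y" using eq e(2) by (auto simp: dist_commute subset_iff)
  qed
  then have "D0 t = D t" if "t \<in> S" for t
    using has_derivative_within_subspace_unique[OF S D0(1) _ that] by blast
  then have "D0 ` S = D ` S" by (rule image_cong[OF refl])
  then show ?thesis using D0(2) by simp
qed

section \<open>Solutions of the profile equation\<close>

text \<open>The profile equation as a first-order system for \<open>(w, w1)\<close>. Having the derivative \<open>w1\<close> as an
  argument makes restriction, translation and gluing of solutions immediate, while
  \<open>dz S w\<close> depends on \<open>S\<close>.\<close>

definition solves ::
  "('d::finite \<Rightarrow> real^'n \<Rightarrow> real^'n^'n) \<Rightarrow> 'd \<Rightarrow> (real^'n) set \<Rightarrow> real^'d \<Rightarrow> real set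
    \<Rightarrow> (real \<Rightarrow> real^'n) \<Rightarrow> (real \<Rightarrow> real^'n) \<Rightarrow> bool" where
  "solves A l Ustar \<sigma> S w w1 \<longleftrightarrow> (\<forall>z\<in>S. w z \<in> Ustar \<and> (w has_vector_derivative w1 z) (at z within S) \<and>
     (w1 has_vector_derivative (1 / (1 + hnorm2 l \<sigma>)) *\<^sub>R (Ad A l (w z) \<sigma> *v w1 z)) (at z within S))"

lemma hnorm2_pos: "1 + hnorm2 l \<sigma> > 0"
  unfolding hnorm2_def by (smt (verit) sum_nonneg zero_le_power2)

lemma profile_eq_on_imp_solves:
  assumes "profile_eq_on A l Ustar \<sigma> S w"
  shows "solves A l Ustar \<sigma> S w (dz S w)"
  unfolding solves_def
proof
  fix z assume "z \<in> S"
  then have *: "w z \<in> Ustar" "w differentiable (at z within S)" "dz S w differentiable (at z within S)"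
    "(1 + hnorm2 l \<sigma>) *\<^sub>R dz S (dz S w) z = Ad A l (w z) \<sigma> *v dz S w z"
    using assms by (auto simp: profile_eq_on_def)
  have "dz S (dz S w) z = (1 / (1 + hnorm2 l \<sigma>)) *\<^sub>R (Ad A l (w z) \<sigma> *v dz S w z)"
    unfolding *(4)[symmetric] using hnorm2_pos[of l \<sigma>] by simp
  then show "w z \<in> Ustar \<and> (w has_vector_derivative dz S w z) (at z within S) \<and>
     (dz S w has_vector_derivative (1 / (1 + hnorm2 l \<sigma>)) *\<^sub>R (Ad A l (w z) \<sigma> *v dz S w z)) (at z within S)"
    using * unfolding dz_def by (metis vector_derivative_works)
qed

text \<open>The condition on the filter says that \<open>z\<close> is not isolated in \<open>S\<close>; otherwise every vector is a
  derivative of \<open>w\<close> at \<open>z\<close> within \<open>S\<close>.\<close>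

lemma solves_dz_eq:
  assumes "solves A l Ustar \<sigma> S w w1" "z \<in> S" "at z within S \<noteq> bot"
  shows "dz S w z = w1 z"
  using assms unfolding solves_def dz_def by (metis vector_derivative_within)

lemma solves_imp_profile_eq_on:
  assumes s: "solves A l Ustar \<sigma> S w w1" and nt: "\<And>z. z \<in> S \<Longrightarrow> at z within S \<noteq> bot"
  shows "profile_eq_on A l Ustar \<sigma> S w"
  unfolding profile_eq_on_def
proof
  fix z assume z: "z \<in> S"
  let ?d = "(1 / (1 + hnorm2 l \<sigma>)) *\<^sub>R (Ad A l (w z) \<sigma> *v w1 z)"
  have "(dz S w has_vector_derivative ?d) (at z within S)"
    using s z by (intro has_vector_derivative_transform[of z S "dz S w" w1])
      (auto simp: solves_def solves_dz_eq[OF s] nt)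
  then have "dz S (dz S w) z = ?d" "dz S w differentiable (at z within S)"
    using vector_derivative_within[OF nt[OF z]] by (auto simp: dz_def[of S "dz S w"] intro: differentiableI_vector)
  then show "w z \<in> Ustar \<and> w differentiable (at z within S) \<and> dz S w differentiable (at z within S) \<and>
       (1 + hnorm2 l \<sigma>) *\<^sub>R dz S (dz S w) z = Ad A l (w z) \<sigma> *v dz S w z"
    using s z hnorm2_pos[of l \<sigma>] solves_dz_eq[OF s z nt[OF z]]
    by (auto simp: solves_def intro: differentiableI_vector)
qed

lemma solves_subset:
  "solves A l Ustar \<sigma> S w w1 \<Longrightarrow> S' \<subseteq> S \<Longrightarrow> solves A l Ustar \<sigma> S' w w1"
  unfolding solves_def by (meson has_vector_derivative_within_subset subsetD)

lemma solves_shift: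
  assumes "solves A l Ustar \<sigma> S w w1"
  shows "solves A l Ustar \<sigma> {z. z + c \<in> S} (\<lambda>z. w (z + c)) (\<lambda>z. w1 (z + c))"
proof -
  have img: "(\<lambda>z. z + c) ` {z. z + c \<in> S} = S"
    by (auto simp: image_iff) (metis diff_add_cancel)
  have *: "((\<lambda>z. f (z + c)) has_vector_derivative f') (at z within {z. z + c \<in> S})"
    if "(f has_vector_derivative f') (at (z + c) within S)" for f :: "real \<Rightarrow> real^'b" and f' z
  proof -
    have "((\<lambda>z. z + c) has_vector_derivative 1) (at z within {z. z + c \<in> S})"
      by (auto intro!: derivative_eq_intros)
    from vector_diff_chain_within[OF this, of f f'] show ?thesis
      using that unfolding img by (simp add: o_def)
  qed
  show ?thesis using assms unfolding solves_def by (auto intro!: *)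
qed

text \<open>The equation expresses the second derivative through \<open>w\<close> and \<open>w'\<close>, so matching values and first
  derivatives at \<open>0\<close> force the one-sided second derivatives to match.\<close>

lemma solves_glue:
  assumes p: "solves A l Ustar \<sigma> {0..} wp wp1" and m: "solves A l Ustar \<sigma> {..0} wm wm1"
    and 0: "wp 0 = wm 0" "wp1 0 = wm1 0"
  shows "solves A l Ustar \<sigma> UNIV (\<lambda>z. if 0 \<le> z then wp z else wm z) (\<lambda>z. if 0 \<le> z then wp1 z else wm1 z)"
proof -
  have glue: "((\<lambda>z. if 0 \<le> z then f z else g z) has_vector_derivative (if 0 \<le> z then f' z else g' z)) (at z)"
    if "\<And>z. z \<ge> 0 \<Longrightarrow> (f has_vector_derivative f' z) (at z within {0..})"
      "\<And>z. z \<le> 0 \<Longrightarrow> (g has_vector_derivative g' z) (at z within {..0})" "f 0 = g 0" "f' 0 = g' 0"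
    for f g f' g' :: "real \<Rightarrow> real^'b" and z
  proof -
    have cl: "closure {..<0::real} = {..0}" "{0..} \<union> ({0..} \<inter> {..0}) = {0::real..}"
      "{..<0} \<union> ({0..} \<inter> {..0}) = {..0::real}" "{0..} \<union> {..<0} = (UNIV :: real set)" by auto
    have "((\<lambda>z. if z \<in> {0..} then f z else g z) has_derivative
        (if z \<in> {0..} then (\<lambda>h. h *\<^sub>R f' z) else (\<lambda>h. h *\<^sub>R g' z))) (at z within {0..} \<union> {..<0})"
      by (rule has_derivative_If_within_closures[where f'="\<lambda>z h. h *\<^sub>R f' z" and g'="\<lambda>z h. h *\<^sub>R g' z"])
        (use that in \<open>auto simp: cl has_vector_derivative_def\<close>)
    then show ?thesis
      by (simp add: cl(4) has_vector_derivative_def split: if_splits)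
  qed
  show ?thesis
    unfolding solves_def
  proof (intro ballI conjI)
    fix z :: real
    show "(if 0 \<le> z then wp z else wm z) \<in> Ustar"
      using p m by (auto simp: solves_def)
    show "((\<lambda>z. if 0 \<le> z then wp z else wm z) has_vector_derivative (if 0 \<le> z then wp1 z else wm1 z)) (at z)"
      by (rule glue) (use p m 0 in \<open>auto simp: solves_def\<close>)
    have "((\<lambda>z. if 0 \<le> z then wp1 z else wm1 z) has_vector_derivative
        (if 0 \<le> z then (1 / (1 + hnorm2 l \<sigma>)) *\<^sub>R (Ad A l (wp z) \<sigma> *v wp1 z)
         else (1 / (1 + hnorm2 l \<sigma>)) *\<^sub>R (Ad A l (wm z) \<sigma> *v wm1 z))) (at z)"
      by (rule glue[where f'="\<lambda>z. (1 / (1 + hnorm2 l \<sigma>)) *\<^sub>R (Ad A l (wp z) \<sigma> *v wp1 z)"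
            and g'="\<lambda>z. (1 / (1 + hnorm2 l \<sigma>)) *\<^sub>R (Ad A l (wm z) \<sigma> *v wm1 z)"])
        (use p m 0 in \<open>auto simp: solves_def\<close>)
    then show "((\<lambda>z. if 0 \<le> z then wp1 z else wm1 z) has_vector_derivative
      (1 / (1 + hnorm2 l \<sigma>)) *\<^sub>R (Ad A l (if 0 \<le> z then wp z else wm z) \<sigma> *v (if 0 \<le> z then wp1 z else wm1 z))) (at z)"
      by (simp split: if_splits)
  qed
qed

lemma bounded_bilinear_matrix_vector_mult:
  "bounded_bilinear ((*v) :: real^'n^'m \<Rightarrow> real^'n \<Rightarrow> real^'m)"
  unfolding bilinear_conv_bounded_bilinear[symmetric] bilinear_def
  by (auto intro!: linearI simp: matrix_vector_mult_add_rdistrib matrix_vector_right_distrib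
      matrix_vector_mult_scaleR scaleR_matrix_vector_assoc)

lemma smooth_on_Ad:
  fixes A :: "'d::finite \<Rightarrow> real^'n \<Rightarrow> real^'n^'n"
  assumes "\<And>j. smooth_on Ustar (A j)" "open Ustar"
  shows "smooth_on Ustar (\<lambda>u. Ad A l u \<sigma>)"
proof -
  have A: "Ck_on n Ustar (A j)" for n j using assms(1)[of j] unfolding smooth_on_open_iff[OF assms(2)] by blast
  have "smooth_on Ustar (\<lambda>u. \<Sum>j\<in>UNIV - {l}. (\<sigma> $ j) *\<^sub>R A j u)"
    unfolding smooth_on_open_iff[OF assms(2)]
    by (intro allI Ck_on_sum[OF assms(2)] Ck_on_bounded_linear[OF bounded_linear_scaleR_right assms(2)] A)
  then show ?thesis unfolding Ad_def by (intro smooth_on_diff assms smooth_on_const)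
qed

text \<open>Bootstrapping: if \<open>w\<close> and \<open>w'\<close> are of class \<open>C\<^sup>n\<close>, then so are the right-hand sides \<open>w'\<close> and
  \<open>(1 + |h|\<^sup>2)\<inverse> \<A>\<^sub>d(w) w'\<close> of the first-order system, whence \<open>w\<close> and \<open>w'\<close> are of class \<open>C\<^sup>n\<^sup>+\<^sup>1\<close>.\<close>

lemma solution_smooth:
  fixes A :: "'d::finite \<Rightarrow> real^'n \<Rightarrow> real^'n^'n"
  assumes A: "\<And>j. smooth_on Ustar (A j)" "open Ustar" and s: "solves A l Ustar \<sigma> UNIV w w1"
  shows "smooth_on UNIV w"
proof -
  have w: "w z \<in> Ustar" "(w has_derivative (\<lambda>h. h *\<^sub>R w1 z)) (at z)"
    "(w1 has_derivative (\<lambda>h. h *\<^sub>R ((1 / (1 + hnorm2 l \<sigma>)) *\<^sub>R (Ad A l (w z) \<sigma> *v w1 z)))) (at z)" for z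
    using s by (auto simp: solves_def has_vector_derivative_def)
  have Ad: "Ck_on n Ustar (\<lambda>u. Ad A l u \<sigma>)" for n
    using smooth_on_Ad[where A=A, OF A, where l=l and \<sigma>=\<sigma>] unfolding smooth_on_open_iff[OF A(2)] by blast
  have "Ck_on n UNIV w \<and> Ck_on n UNIV w1" for n
  proof (induction n)
    case 0
    then show ?case
      using has_derivative_continuous[OF w(2)] has_derivative_continuous[OF w(3)]
      by (simp add: continuous_at_imp_continuous_on)
  next
    case (Suc n)
    have "Ck_on n UNIV (\<lambda>z. Ad A l (w z) \<sigma>)"
      using Ck_on_compose[OF open_UNIV A(2) conjunct1[OF Suc] Ad] w(1) by blast
    from Ck_on_bounded_bilinear[OF bounded_bilinear_matrix_vector_mult open_UNIV this conjunct2[OF Suc]]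
    have "Ck_on n UNIV (\<lambda>z. v *\<^sub>R ((1 / (1 + hnorm2 l \<sigma>)) *\<^sub>R (Ad A l (w z) \<sigma> *v w1 z)))" for v
      by (intro Ck_on_bounded_linear[OF bounded_linear_scaleR_right open_UNIV])
    moreover have "Ck_on n UNIV (\<lambda>z. v *\<^sub>R w1 z)" for v
      using Ck_on_bounded_linear[OF bounded_linear_scaleR_right open_UNIV conjunct2[OF Suc]] .
    ultimately show ?case
      by (intro conjI Ck_on_SucI[OF open_UNIV w(2)] Ck_on_SucI[OF open_UNIV w(3)])
  qed
  then show ?thesis by (simp add: smooth_on_open_iff)
qed

lemma half_line_simps: "half_line 1 = {0..}" "half_line (-1) = {..0}"
  by (auto simp: half_line_def)

lemma at_within_half_line_nontrivial:
  "z \<ge> 0 \<Longrightarrow> at z within {0::real..} \<noteq> bot" "z \<le> 0 \<Longrightarrow> at z within {..0::real} \<noteq> bot"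
proof -
  show "at z within {0::real..} \<noteq> bot" if "z \<ge> 0"
  proof
    assume "at z within {0..} = bot"
    moreover have "at_right z \<le> at z within {0..}" using that by (intro at_le) auto
    ultimately show False using trivial_limit_at_right_real[of z] bot.extremum_uniqueI by metis
  qed
  show "at z within {..0::real} \<noteq> bot" if "z \<le> 0"
  proof
    assume "at z within {..0} = bot"
    moreover have "at_left z \<le> at z within {..0}" using that by (intro at_le) auto
    ultimately show False using trivial_limit_at_left_real[of z] bot.extremum_uniqueI by metis
  qed
qed

lemma glued_viscous_profile:
  fixes A :: "'d::finite \<Rightarrow> real^'n \<Rightarrow> real^'n^'n"
  assumes A: "\<And>j. smooth_on Ustar (A j)" "open Ustar"
    and p: "solves A l Ustar \<sigma> {0..} wp wp1" and m: "solves A l Ustar \<sigma> {..0} wm wm1"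
    and 0: "wp 0 = wm 0" "wp1 0 = wm1 0" and lim: "(wp \<longlongrightarrow> pp) at_top" "(wm \<longlongrightarrow> pm) at_bot"
  shows "viscous_profile A l Ustar ((pp, pm), \<sigma>) (\<lambda>z. if 0 \<le> z then wp z else wm z)"
proof -
  have s: "solves A l Ustar \<sigma> UNIV (\<lambda>z. if 0 \<le> z then wp z else wm z) (\<lambda>z. if 0 \<le> z then wp1 z else wm1 z)"
    by (rule solves_glue[OF p m 0])
  have "((\<lambda>z. if 0 \<le> z then wp z else wm z) \<longlongrightarrow> pp) at_top"
    using lim(1) by (rule Lim_transform_eventually) (auto simp: eventually_at_top_linorder intro!: exI[of _ 0])
  moreover have "((\<lambda>z. if 0 \<le> z then wp z else wm z) \<longlongrightarrow> pm) at_bot"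
    using lim(2) by (rule Lim_transform_eventually) (auto simp: eventually_at_bot_dense intro!: exI[of _ 0])
  ultimately show ?thesis
    using solution_smooth[OF A s] solves_imp_profile_eq_on[OF s] by (simp add: viscous_profile_def)
qed

section \<open>Half-line profiles and their maximal extensions\<close>

text \<open>A union of intervals that all contain \<open>0\<close> is an interval.\<close>

lemma max_interval_facts:
  assumes "profile_eq_on A l Ustar \<sigma> (half_line \<epsilon>) w" and \<epsilon>: "\<epsilon> = 1 \<or> \<epsilon> = -1"
  shows "is_interval (max_interval A l Ustar \<epsilon> \<sigma> w)" "half_line \<epsilon> \<subseteq> max_interval A l Ustar \<epsilon> \<sigma> w"
proof -
  have "connected (max_interval A l Ustar \<epsilon> \<sigma> w)"
    unfolding max_interval_def
  proof (rule connected_Union)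
    have "0 \<in> half_line \<epsilon>" by (simp add: half_line_def)
    then show "\<Inter> {J. is_interval J \<and> half_line \<epsilon> \<subseteq> J \<and>
        (\<exists>v. profile_eq_on A l Ustar \<sigma> J v \<and> (\<forall>z\<in>half_line \<epsilon>. v z = w z))} \<noteq> {}" by blast
  qed (auto simp: is_interval_connected_1)
  then show "is_interval (max_interval A l Ustar \<epsilon> \<sigma> w)" by (simp add: is_interval_connected_1)
  have "is_interval (half_line \<epsilon>)"
    using \<epsilon> half_line_simps by auto
  then show "half_line \<epsilon> \<subseteq> max_interval A l Ustar \<epsilon> \<sigma> w"
    unfolding max_interval_def using assms(1) by (intro Union_upper) auto
qed

text \<open>A profile on the whole line, translated by \<open>\<epsilon> zbar\<close>, extends the half-line profile from which it
  arises; \<open>zbar \<le> 0\<close> makes the translated half-line large enough to contain \<open>half_line \<epsilon>\<close>. In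
  particular \<open>\<epsilon> zbar\<close>, where \<open>\<Psi>\<close> evaluates the profile, is in the interval of existence although
  it lies outside \<open>half_line \<epsilon>\<close> for \<open>zbar < 0\<close>.\<close>

lemma max_interval_UNIV:
  assumes v: "viscous_profile A l Ustar ((pp, pm), \<sigma>) w" and \<epsilon>: "\<epsilon> = 1 \<or> \<epsilon> = -1" and "zbar \<le> 0"
    and w: "\<And>z. \<epsilon> * z \<ge> 0 \<Longrightarrow> w z = u (z + \<epsilon> * zbar)"
  shows "max_interval A l Ustar \<epsilon> \<sigma> u = UNIV"
proof -
  have "solves A l Ustar \<sigma> UNIV w (dz UNIV w)"
    using v by (intro profile_eq_on_imp_solves) (simp add: viscous_profile_def)
  from solves_shift[OF this, of "- \<epsilon> * zbar"]
  have "profile_eq_on A l Ustar \<sigma> UNIV (\<lambda>z. w (z + - \<epsilon> * zbar))"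
    by (intro solves_imp_profile_eq_on) auto
  moreover have "w (z + - \<epsilon> * zbar) = u z" if "z \<in> half_line \<epsilon>" for z
    using w[of "z + - \<epsilon> * zbar"] that \<epsilon> \<open>zbar \<le> 0\<close> by (auto simp: half_line_def)
  ultimately have "UNIV \<in> {J. is_interval J \<and> half_line \<epsilon> \<subseteq> J \<and>
        (\<exists>v. profile_eq_on A l Ustar \<sigma> J v \<and> (\<forall>z\<in>half_line \<epsilon>. v z = u z))}"
    by (auto simp: is_interval_univ)
  then show ?thesis unfolding max_interval_def by blast
qed

text \<open>The domain \<open>D\<close> in \<open>half_profile_family\<close>.\<close>

definition flow_domain where
  "flow_domain A l Ustar \<epsilon> p0 V r \<Phi> = {(z, q, a). q \<in> V \<and> a \<in> E_base A l \<epsilon> p0 \<and> norm a < r \<and>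
     z \<in> max_interval A l Ustar \<epsilon> (snd q) (\<lambda>z. \<Phi> z q a)}"

lemma half_profile_family_elims:
  assumes "half_profile_family A l Ustar \<epsilon> p0 V \<alpha> R r \<Phi>"
  shows "openin (top_of_set (UNIV \<times> V \<times> {a \<in> E_base A l \<epsilon> p0. norm a < r})) (flow_domain A l Ustar \<epsilon> p0 V r \<Phi>)"
    "smooth_on (flow_domain A l Ustar \<epsilon> p0 V r \<Phi>) (\<lambda>(z, q, a). \<Phi> z q a)"
    "\<And>q a. q \<in> V \<Longrightarrow> a \<in> E_base A l \<epsilon> p0 \<Longrightarrow> norm a \<le> r \<Longrightarrow> half_profile A l Ustar \<epsilon> \<alpha> R q a (\<lambda>z. \<Phi> z q a)"
    "\<And>q a. q \<in> V \<Longrightarrow> a \<in> E_base A l \<epsilon> p0 \<Longrightarrow> norm a \<le> r \<Longrightarrow>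
       profile_eq_on A l Ustar (snd q) (max_interval A l Ustar \<epsilon> (snd q) (\<lambda>z. \<Phi> z q a)) (\<lambda>z. \<Phi> z q a)"
  using assms unfolding half_profile_family_def flow_domain_def Let_def by auto

text \<open>As soon as \<open>\<epsilon> zbar\<close> lies in the interval of existence, so does the half-line ending there, and the
  translated profile solves the equation on \<open>half_line \<epsilon>\<close>. The domain is relatively open, hence
  \<open>\<epsilon> zbar\<close> is an interior point, and the one-sided derivative at the end of the half-line is the
  two-sided derivative that enters \<open>\<Psi>\<close>.\<close>

lemma flow_half_line:
  assumes fam: "half_profile_family A l Ustar \<epsilon> p0 V \<alpha> R r \<Phi>" and \<epsilon>: "\<epsilon> = 1 \<or> \<epsilon> = -1"
    and dom: "(\<epsilon> * zbar, q, a) \<in> flow_domain A l Ustar \<epsilon> p0 V r \<Phi>"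
  obtains f1 where "solves A l Ustar (snd q) (half_line \<epsilon>) (\<lambda>z. phi \<epsilon> zbar \<Phi> z q a) f1"
    "f1 0 = vector_derivative (\<lambda>z. phi \<epsilon> zbar \<Phi> z q a) (at 0)"
    "((\<lambda>t. phi \<epsilon> zbar \<Phi> (\<epsilon> * t) q a) \<longlongrightarrow> fst q) at_top"
    "\<And>z. z \<in> half_line \<epsilon> \<Longrightarrow> (z + \<epsilon> * zbar, q, a) \<in> flow_domain A l Ustar \<epsilon> p0 V r \<Phi>"
proof -
  define J where "J = max_interval A l Ustar \<epsilon> (snd q) (\<lambda>z. \<Phi> z q a)"
  have qa: "q \<in> V" "a \<in> E_base A l \<epsilon> p0" "norm a < r" "\<epsilon> * zbar \<in> J"
    using dom by (auto simp: flow_domain_def J_def)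
  have hp: "half_profile A l Ustar \<epsilon> \<alpha> R q a (\<lambda>z. \<Phi> z q a)" and pe: "profile_eq_on A l Ustar (snd q) J (\<lambda>z. \<Phi> z q a)"
    using half_profile_family_elims(3,4)[OF fam] qa by (auto simp: J_def)
  have J: "is_interval J" "half_line \<epsilon> \<subseteq> J"
    unfolding J_def using hp by (simp_all add: max_interval_facts[OF _ \<epsilon>] half_profile_def)
  have memJ: "z + \<epsilon> * zbar \<in> J" if "z \<in> half_line \<epsilon>" for z
  proof (cases "z + \<epsilon> * zbar \<in> half_line \<epsilon>")
    case False
    have "0 \<in> J" using J(2) by (auto simp: half_line_def)
    show ?thesis
    proof (cases "\<epsilon> = 1")
      case True
      then show ?thesis using False that
        using mem_is_interval_1_I[OF J(1) qa(4) \<open>0 \<in> J\<close>, of "z + \<epsilon> * zbar"] by (simp add: half_line_def)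
    next
      case False
      with \<epsilon> have "\<epsilon> = -1" by simp
      then show ?thesis using \<open>z + \<epsilon> * zbar \<notin> half_line \<epsilon>\<close> that
        using mem_is_interval_1_I[OF J(1) \<open>0 \<in> J\<close> qa(4), of "z + \<epsilon> * zbar"] by (simp add: half_line_def)
    qed
  qed (use J in auto)
  have "solves A l Ustar (snd q) J (\<lambda>z. \<Phi> z q a) (dz J (\<lambda>z. \<Phi> z q a))"
    by (rule profile_eq_on_imp_solves[OF pe])
  from solves_shift[OF this, of "\<epsilon> * zbar"]
  have s: "solves A l Ustar (snd q) {z. z + \<epsilon> * zbar \<in> J} (\<lambda>z. phi \<epsilon> zbar \<Phi> z q a)
      (\<lambda>z. dz J (\<lambda>z. \<Phi> z q a) (z + \<epsilon> * zbar))" (is "solves _ _ _ _ ?S ?f ?f1")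
    by (simp add: phi_def)
  have "open ?S"
  proof -
    obtain T where T: "open T" "flow_domain A l Ustar \<epsilon> p0 V r \<Phi> = (UNIV \<times> V \<times> {a \<in> E_base A l \<epsilon> p0. norm a < r}) \<inter> T"
      using half_profile_family_elims(1)[OF fam, unfolded openin_open] by (elim exE conjE)
    have "z \<in> J \<longleftrightarrow> (z, q, a) \<in> flow_domain A l Ustar \<epsilon> p0 V r \<Phi>" for z
      using qa by (simp add: flow_domain_def J_def)
    then have "?S = (\<lambda>z. (z + \<epsilon> * zbar, q, a)) -` T"
      unfolding T(2) using qa by auto
    then show ?thesis using T(1) by (simp add: open_vimage continuous_intros)
  qed
  have "(?f has_vector_derivative ?f1 0) (at 0)"
  proof -
    have "0 \<in> ?S" using qa(4) by simp
    then show ?thesis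
      using s[unfolded solves_def, rule_format, of 0] at_within_open[OF _ \<open>open ?S\<close>, of 0] by simp
  qed
  then have "vector_derivative ?f (at 0) = ?f1 0" by (rule vector_derivative_at)
  moreover have "((\<lambda>t. phi \<epsilon> zbar \<Phi> (\<epsilon> * t) q a) \<longlongrightarrow> fst q) at_top"
  proof -
    have "((\<lambda>t. \<Phi> (\<epsilon> * t) q a) \<longlongrightarrow> fst q) at_top" using hp by (simp add: half_profile_def)
    from filterlim_compose[OF this filterlim_tendsto_add_at_top[OF tendsto_const[of zbar] filterlim_ident]]
    show ?thesis by (simp add: phi_def algebra_simps)
  qed
  moreover have "half_line \<epsilon> \<subseteq> ?S" using memJ by auto
  ultimately show ?thesis
    using that[OF solves_subset[OF s]] memJ qa by (auto simp: flow_domain_def J_def)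
qed

text \<open>Smoothness on the relatively open domain means that \<open>\<Phi>\<close> agrees there with a smooth function \<open>g\<close>
  on an open set, in which \<open>a\<close> is not confined to \<open>E_base\<close>.\<close>

lemma flow_local_extension:
  assumes fam: "half_profile_family A l Ustar \<epsilon> p0 V \<alpha> R r \<Phi>" and V: "open V"
    and dom: "(z0, q0, a0) \<in> flow_domain A l Ustar \<epsilon> p0 V r \<Phi>"
  obtains N g where "open N" "(z0, q0, a0) \<in> N" "smooth_on N g"
    "\<And>z q a. (z, q, a) \<in> N \<Longrightarrow> a \<in> E_base A l \<epsilon> p0 \<Longrightarrow>
       (z, q, a) \<in> flow_domain A l Ustar \<epsilon> p0 V r \<Phi> \<and> g (z, q, a) = \<Phi> z q a"
proof -
  let ?D = "flow_domain A l Ustar \<epsilon> p0 V r \<Phi>" and ?E = "E_base A l \<epsilon> p0"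
  obtain T where T: "open T" "?D = (UNIV \<times> V \<times> {a \<in> ?E. norm a < r}) \<inter> T"
    using half_profile_family_elims(1)[OF fam, unfolded openin_open] by (elim exE conjE)
  obtain U g where U: "open U" "(z0, q0, a0) \<in> U" "\<forall>n. Ck_on n U g"
      "\<forall>y\<in>?D \<inter> U. g y = (case y of (z, q, a) \<Rightarrow> \<Phi> z q a)"
    using half_profile_family_elims(2)[OF fam, unfolded smooth_on_def, rule_format, OF dom] by (elim exE conjE)
  define N where "N = U \<inter> T \<inter> (UNIV \<times> V \<times> ball 0 r)"
  have "open N" unfolding N_def using U(1) T(1) V by (intro open_Int open_Times) auto
  moreover have "(z0, q0, a0) \<in> N"
    using U(2) dom T(2) unfolding N_def by (auto simp: flow_domain_def)
  moreover have "smooth_on N g"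
    unfolding smooth_on_open_iff[OF \<open>open N\<close>] using U(3) Ck_on_subset[of _ U g N] by (auto simp: N_def)
  moreover have "(z, q, a) \<in> ?D \<and> g (z, q, a) = \<Phi> z q a" if "(z, q, a) \<in> N" "a \<in> ?E" for z q a
  proof -
    have "(z, q, a) \<in> ?D" using that unfolding N_def T(2) by auto
    moreover have "(z, q, a) \<in> U" using that by (auto simp: N_def)
    ultimately show ?thesis using U(4) by auto
  qed
  ultimately show ?thesis by (rule that)
qed

lemma vector_derivative_flow:
  fixes g :: "real \<times> 'q::euclidean_space \<times> 'a::euclidean_space \<Rightarrow> real^'n"
  assumes N: "open N" "smooth_on N g" "(\<epsilon> * zbar, q, a) \<in> N"
    and eq: "\<And>z. (z, q, a) \<in> N \<Longrightarrow> g (z, q, a) = \<Phi> z q a"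
  shows "vector_derivative (\<lambda>z. phi \<epsilon> zbar \<Phi> z q a) (at 0) = frechet_derivative g (at (\<epsilon> * zbar, q, a)) (1, 0, 0)"
proof -
  let ?D = "frechet_derivative g (at (\<epsilon> * zbar, q, a))"
  have D: "(g has_derivative ?D) (at (0 + \<epsilon> * zbar, q, a))"
    using smooth_on_has_derivative[OF N] by simp
  have "((\<lambda>z. (z + \<epsilon> * zbar, q, a)) has_derivative (\<lambda>h. (h, 0, 0))) (at 0)"
    by (auto intro!: derivative_eq_intros simp: zero_prod_def)
  from has_derivative_compose[OF this D]
  have "((\<lambda>z. g (z + \<epsilon> * zbar, q, a)) has_derivative (\<lambda>h. ?D (h, 0, 0))) (at 0)" .
  moreover have "(\<lambda>h. ?D (h, 0, 0)) = (\<lambda>h. h *\<^sub>R ?D (1, 0, 0))"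
  proof
    show "?D (h, 0, 0) = h *\<^sub>R ?D (1, 0, 0)" for h
      using linear_scale[OF has_derivative_linear[OF D], of h "(1, 0, 0)"] by simp
  qed
  ultimately have "((\<lambda>z. g (z + \<epsilon> * zbar, q, a)) has_vector_derivative ?D (1, 0, 0)) (at 0)"
    unfolding has_vector_derivative_def by (rule back_subst[where P="\<lambda>D. (_ has_derivative D) _"])
  then have "((\<lambda>z. phi \<epsilon> zbar \<Phi> z q a) has_vector_derivative ?D (1, 0, 0)) (at 0)"
  proof (rule has_vector_derivative_transform_within_open)
    show "open ((\<lambda>z. (z + \<epsilon> * zbar, q, a)) -` N)"
      by (intro open_vimage N(1) continuous_intros)
  qed (use N(3) eq in \<open>auto simp: phi_def\<close>)
  then show ?thesis by (rule vector_derivative_at)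
qed

text \<open>The one-sided derivative of the half of \<open>w\<close> given by \<open>f\<close> is the two-sided derivative of \<open>w\<close>. This
  shows that the base point is a zero of \<open>\<Psi>\<close>.\<close>

lemma derivative_of_half_line_solution_at_0:
  assumes w: "(w has_vector_derivative wz) (at 0)" and \<epsilon>: "\<epsilon> = 1 \<or> \<epsilon> = -1"
    and f: "solves A l Ustar \<sigma> (half_line \<epsilon>) f f1" and eq: "\<And>z. z \<in> half_line \<epsilon> \<Longrightarrow> w z = f z"
  shows "f1 0 = wz"
proof -
  have 0: "0 \<in> half_line \<epsilon>" by (simp add: half_line_def)
  have "(f has_vector_derivative f1 0) (at 0 within half_line \<epsilon>)"
    using f 0 by (auto simp: solves_def)
  then have "(w has_vector_derivative f1 0) (at 0 within half_line \<epsilon>)"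
    by (rule has_vector_derivative_transform[OF 0, rotated]) (rule eq)
  moreover have "(w has_vector_derivative wz) (at 0 within half_line \<epsilon>)"
    using w by (rule has_vector_derivative_at_within)
  moreover have "at 0 within half_line \<epsilon> \<noteq> bot"
    using \<epsilon> half_line_simps at_within_half_line_nontrivial[of 0] by auto
  ultimately show ?thesis using vector_derivative_unique_within by blast
qed

lemma flow_domain_half_line:
  assumes "half_profile_family A l Ustar \<epsilon> p0 V \<alpha> R r \<Phi>" "\<epsilon> = 1 \<or> \<epsilon> = -1"
    "(\<epsilon> * zbar, q, a) \<in> flow_domain A l Ustar \<epsilon> p0 V r \<Phi>" and z: "z \<in> half_line \<epsilon>"
  shows "(z + \<epsilon> * zbar, q, a) \<in> flow_domain A l Ustar \<epsilon> p0 V r \<Phi>"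
proof (rule flow_half_line[OF assms(1-3)], goal_cases)
  case (1 f1)
  then show ?case using z by blast
qed

section \<open>The family of connections\<close>

text \<open>The reduction is applied to a smooth map \<open>F\<close> on an open set \<open>\<Omega>\<close> that coincides with \<open>Psi\<close> where
  \<open>a \<in> E\<close>; the space \<open>T\<close> of directions is left arbitrary to treat both rank conditions at once.\<close>

lemma connection_family_exists:
  fixes A :: "'d::finite \<Rightarrow> real^'n \<Rightarrow> real^'n^'n" and T :: "('n, 'd) conn_param set"
  assumes Ustar: "open Ustar" and smooth_A: "\<And>j. smooth_on Ustar (A j)"
    and w: "viscous_profile A l Ustar ((pp, pm), 0) w"
    and V: "open Vp" "(pp, 0) \<in> Vp" "open Vm" "(pm, 0) \<in> Vm"
    and \<Phi>p: "half_profile_family A l Ustar 1 pp Vp \<alpha>p R r \<Phi>p"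
    and \<Phi>m: "half_profile_family A l Ustar (-1) pm Vm \<alpha>m R r \<Phi>m"
    and zbar: "zbar \<le> 0"
    and ap: "ap \<in> E_base A l 1 pp" "norm ap < r"
    and am: "am \<in> E_base A l (-1) pm" "norm am < r"
    and w_plus: "\<And>z. z \<ge> 0 \<Longrightarrow> w z = phi 1 zbar \<Phi>p z (pp, 0) ap"
    and w_minus: "\<And>z. z \<le> 0 \<Longrightarrow> w z = phi (-1) zbar \<Phi>m z (pm, 0) am"
    and dimE: "dim (E_base A l 1 pp) + dim (E_base A l (-1) pm) + k \<le> CARD('n) + 1"
    and m: "CARD('m::finite) = CARD('n) + k"
    and rank_a: "rank_along (Psi l w zbar \<Phi>p \<Phi>m) (((pp, pm), 0), (ap, am))
              ({0} \<times> (E_base A l 1 pp \<times> E_base A l (-1) pm)) (CARD('n) + 1 - k)"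
    and T: "subspace T"
    and rank_T: "rank_along (Psi l w zbar \<Phi>p \<Phi>m) (((pp, pm), 0), (ap, am))
              (T \<times> (E_base A l 1 pp \<times> E_base A l (-1) pm)) (2 * CARD('n) + 1)"
  shows "\<exists>Q C Wp Wm. \<exists>X :: ('n, 'd) conn_param \<Rightarrow> real^'m.
     connection_family A l Ustar w ((pp, pm), 0) k T Q C Wp Wm X"
proof -
  define Ep where "Ep = E_base A l 1 pp"
  define Em where "Em = E_base A l (-1) pm"
  define E where "E = Ep \<times> Em"
  define q0 :: "('n, 'd) conn_param" where "q0 = ((pp, pm), 0)"
  define b0 where "b0 = (ap, am)"
  define wz where "wz = vector_derivative w (at 0)"
  have sub: "subspace Ep" "subspace Em" by (simp_all add: Ep_def Em_def E_base_eq subspace_EE)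
  then have E: "subspace E" unfolding E_def by (rule subspace_Times)
  have "b0 \<in> E" using ap am by (simp add: b0_def E_def Ep_def Em_def)
  have domp: "(1 * zbar, (pp, 0), ap) \<in> flow_domain A l Ustar 1 pp Vp r \<Phi>p"
    using max_interval_UNIV[OF w, of 1 zbar "\<lambda>z. \<Phi>p z (pp, 0) ap"] w_plus zbar ap V
    by (simp add: flow_domain_def phi_def)
  have domm: "(-1 * zbar, (pm, 0), am) \<in> flow_domain A l Ustar (-1) pm Vm r \<Phi>m"
    using max_interval_UNIV[OF w, of "-1" zbar "\<lambda>z. \<Phi>m z (pm, 0) am"] w_minus zbar am V
    by (simp add: flow_domain_def phi_def)
  obtain Np gp where gp: "open Np" "(1 * zbar, (pp, 0), ap) \<in> Np" "smooth_on Np gp"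
    "\<And>z q a. (z, q, a) \<in> Np \<Longrightarrow> a \<in> Ep \<Longrightarrow>
       (z, q, a) \<in> flow_domain A l Ustar 1 pp Vp r \<Phi>p \<and> gp (z, q, a) = \<Phi>p z q a"
    using flow_local_extension[OF \<Phi>p V(1) domp] unfolding Ep_def by metis
  obtain Nm gm where gm: "open Nm" "(-1 * zbar, (pm, 0), am) \<in> Nm" "smooth_on Nm gm"
    "\<And>z q a. (z, q, a) \<in> Nm \<Longrightarrow> a \<in> Em \<Longrightarrow>
       (z, q, a) \<in> flow_domain A l Ustar (-1) pm Vm r \<Phi>m \<and> gm (z, q, a) = \<Phi>m z q a"
    using flow_local_extension[OF \<Phi>m V(3) domm] unfolding Em_def by metis
  \<comment> \<open>\<open>ip\<close> and \<open>im\<close> collect the arguments at which \<open>\<Psi>\<close> evaluates \<open>\<Phi>\<^sub>+\<close> and \<open>\<Phi>\<^sub>-\<close>.\<close>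
  define ip where "ip = (\<lambda>x :: ('n, 'd) conn_param \<times> ((real^'n) \<times> (real^'n)).
    (1 * zbar, (fst (fst (fst x)), snd (fst x)), fst (snd x)))"
  define im where "im = (\<lambda>x :: ('n, 'd) conn_param \<times> ((real^'n) \<times> (real^'n)).
    (-1 * zbar, (snd (fst (fst x)), snd (fst x)), snd (snd x)))"
  define \<Omega> where "\<Omega> = ip -` Np \<inter> im -` Nm"
  have sm_ip: "smooth_on S ip" and sm_im: "smooth_on S im" for S
    unfolding ip_def im_def
    by (intro smooth_on_Pair smooth_on_const smooth_on_bounded_linear bounded_linear_intros)+
  have "open \<Omega>"
    unfolding \<Omega>_def
    by (intro open_Int open_vimage gp(1) gm(1) smooth_on_continuous[OF open_UNIV] sm_ip sm_im)
  have "(q0, b0) \<in> \<Omega>" using gp(2) gm(2) by (simp add: \<Omega>_def ip_def im_def q0_def b0_def)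
  define F where "F = (\<lambda>x. (gp (ip x) - gm (im x),
     frechet_derivative gp (at (ip x)) (1, 0, 0) - frechet_derivative gm (at (im x)) (1, 0, 0),
     snd (fst x) $ l + gp (ip x) \<bullet> wz - w 0 \<bullet> wz))"
  have sF: "smooth_on \<Omega> F"
  proof -
    have \<Omega>N: "ip ` \<Omega> \<subseteq> Np" "im ` \<Omega> \<subseteq> Nm" by (auto simp: \<Omega>_def)
    have 1: "smooth_on \<Omega> (\<lambda>x. gp (ip x))" "smooth_on \<Omega> (\<lambda>x. frechet_derivative gp (at (ip x)) (1, 0, 0))"
      using smooth_on_compose[OF sm_ip gp(3) \<Omega>N(1)]
        smooth_on_compose[OF sm_ip smooth_on_frechet_derivative[OF gp(1,3)] \<Omega>N(1)] .
    have 2: "smooth_on \<Omega> (\<lambda>x. gm (im x))" "smooth_on \<Omega> (\<lambda>x. frechet_derivative gm (at (im x)) (1, 0, 0))"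
      using smooth_on_compose[OF sm_im gm(3) \<Omega>N(2)]
        smooth_on_compose[OF sm_im smooth_on_frechet_derivative[OF gm(1,3)] \<Omega>N(2)] .
    have 3: "smooth_on \<Omega> (\<lambda>x. snd (fst x) $ l)"
      by (rule smooth_on_linear_compose[OF bounded_linear_vec_nth])
        (intro smooth_on_bounded_linear bounded_linear_intros)
    show ?thesis unfolding F_def
      by (intro smooth_on_Pair smooth_on_diff smooth_on_add smooth_on_const 1 2 3
          smooth_on_linear_compose[OF bounded_linear_inner_left 1(1)])
  qed
  have \<Omega>D: "ip (q, b) \<in> flow_domain A l Ustar 1 pp Vp r \<Phi>p" "im (q, b) \<in> flow_domain A l Ustar (-1) pm Vm r \<Phi>m"
    "Psi l w zbar \<Phi>p \<Phi>m (q, b) = F (q, b)" if qb: "(q, b) \<in> \<Omega>" "b \<in> E" for q b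
  proof -
    obtain p1 p2 \<sigma> a1 a2 where q: "q = ((p1, p2), \<sigma>)" and b: "b = (a1, a2)"
      by (cases q; cases b; auto)
    have N: "(1 * zbar, (p1, \<sigma>), a1) \<in> Np" "(-1 * zbar, (p2, \<sigma>), a2) \<in> Nm"
      using qb(1) by (simp_all add: \<Omega>_def ip_def im_def q b)
    have a: "a1 \<in> Ep" "a2 \<in> Em" using qb(2) by (simp_all add: E_def b)
    show "ip (q, b) \<in> flow_domain A l Ustar 1 pp Vp r \<Phi>p" "im (q, b) \<in> flow_domain A l Ustar (-1) pm Vm r \<Phi>m"
      using gp(4)[OF N(1) a(1)] gm(4)[OF N(2) a(2)] by (simp_all add: ip_def im_def q b)
    have "vector_derivative (\<lambda>z. phi 1 zbar \<Phi>p z (p1, \<sigma>) a1) (at 0) =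
        frechet_derivative gp (at (1 * zbar, (p1, \<sigma>), a1)) (1, 0, 0)"
      using gp(4) a(1) by (intro vector_derivative_flow[OF gp(1,3) N(1)]) blast
    moreover have "vector_derivative (\<lambda>z. phi (-1) zbar \<Phi>m z (p2, \<sigma>) a2) (at 0) =
        frechet_derivative gm (at (-1 * zbar, (p2, \<sigma>), a2)) (1, 0, 0)"
      using gm(4) a(2) by (intro vector_derivative_flow[OF gm(1,3) N(2)]) blast
    ultimately show "Psi l w zbar \<Phi>p \<Phi>m (q, b) = F (q, b)"
      using gp(4)[OF N(1) a(1)] gm(4)[OF N(2) a(2)]
      by (simp add: Psi_def Let_def F_def ip_def im_def q b phi_def wz_def)
  qed
  have w0: "(w has_vector_derivative wz) (at 0)"
    using w unfolding viscous_profile_def profile_eq_on_def wz_def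
    by (auto simp: vector_derivative_works)
  have F0: "F (q0, b0) = 0"
  proof -
    obtain f1 where f1: "solves A l Ustar (snd (pp, 0)) (half_line 1) (\<lambda>z. phi 1 zbar \<Phi>p z (pp, 0) ap) f1"
      "f1 0 = vector_derivative (\<lambda>z. phi 1 zbar \<Phi>p z (pp, 0) ap) (at 0)"
      using flow_half_line[OF \<Phi>p _ domp] by metis
    have "f1 0 = wz" by (rule derivative_of_half_line_solution_at_0[OF w0 _ f1(1)]) (auto simp: w_plus half_line_simps)
    obtain f2 where f2: "solves A l Ustar (snd (pm, 0)) (half_line (-1)) (\<lambda>z. phi (-1) zbar \<Phi>m z (pm, 0) am) f2"
      "f2 0 = vector_derivative (\<lambda>z. phi (-1) zbar \<Phi>m z (pm, 0) am) (at 0)"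
      using flow_half_line[OF \<Phi>m _ domm] by metis
    have "f2 0 = wz" by (rule derivative_of_half_line_solution_at_0[OF w0 _ f2(1)]) (auto simp: w_minus half_line_simps)
    then have "Psi l w zbar \<Phi>p \<Phi>m (q0, b0) = 0"
      using \<open>f1 0 = wz\<close> f1(2) f2(2) w_plus[of 0] w_minus[of 0]
      by (simp add: Psi_def Let_def q0_def b0_def wz_def zero_prod_def)
    then show ?thesis using \<Omega>D(3)[OF \<open>(q0, b0) \<in> \<Omega>\<close> \<open>b0 \<in> E\<close>] by simp
  qed
  define D where "D = frechet_derivative F (at (q0, b0))"
  have D: "(F has_derivative D) (at (q0, b0))"
    unfolding D_def by (rule smooth_on_has_derivative[OF \<open>open \<Omega>\<close> sF \<open>(q0, b0) \<in> \<Omega>\<close>])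
  have linD: "linear D" using D by (rule has_derivative_linear)
  have rank: "dim (D ` (S \<times> E)) = n"
    if "subspace S" "rank_along (Psi l w zbar \<Phi>p \<Phi>m) (q0, b0) (S \<times> E) n" for S n
  proof (rule rank_along_local[OF that(2) subspace_Times[OF that(1) E] D \<open>open \<Omega>\<close> \<open>(q0, b0) \<in> \<Omega>\<close>])
    fix v assume v: "v \<in> S \<times> E" "(q0, b0) + v \<in> \<Omega>"
    obtain v1 v2 where v12: "v = (v1, v2)" by (cases v)
    then show "Psi l w zbar \<Phi>p \<Phi>m ((q0, b0) + v) = F ((q0, b0) + v)"
      using \<Omega>D(3)[of "q0 + v1" "b0 + v2"] v subspace_add[OF E \<open>b0 \<in> E\<close>] by simp
  qed
  have De: "D ` ({0} \<times> E) = (\<lambda>b. D (0, b)) ` E" by auto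
  have rank0: "dim ((\<lambda>b. D (0, b)) ` E) = CARD('n) + 1 - k"
    using rank[OF subspace_single_0 rank_a[folded Ep_def Em_def E_def q0_def b0_def]] De by simp
  have dE: "dim E = dim Ep + dim Em" unfolding E_def by (rule dim_Times[OF sub])
  have linDe: "linear (\<lambda>b. D (0, b))"
    using linear_compose[OF _ linD, of "\<lambda>b. (0, b)"]
    by (simp add: o_def linear_conv_bounded_linear bounded_linear_Pair bounded_linear_zero bounded_linear_ident)
  \<comment> \<open>The bound on \<open>dim E\<close> and the rank condition pin down \<open>dim E\<close>, and injectivity follows.\<close>
  have dimE': "dim E = CARD('n) + 1 - k"
    using dimE dE rank0 eucl.dim_image_le[OF linDe, of E] by (simp add: Ep_def Em_def)
  have inj: "\<forall>b\<in>E. D (0, b) = 0 \<longrightarrow> b = 0"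
    using kernel_trivial_of_dim_image[OF linDe E] rank0 dimE' by simp
  have surj: "D ` (T \<times> E) = UNIV"
  proof -
    have "dim (D ` (T \<times> E)) = DIM((real^'n) \<times> (real^'n) \<times> real)"
      using rank[OF T rank_T[folded Ep_def Em_def E_def q0_def b0_def]] by simp
    moreover have "subspace (D ` (T \<times> E))"
      by (intro linear_subspace_image linD subspace_Times T E)
    ultimately show ?thesis using dim_eq_full span_eq_iff by metis
  qed
  have dims: "CARD('m) + dim E = DIM((real^'n) \<times> (real^'n) \<times> real)"
    using m dimE' dimE by simp
  obtain Q a and X :: "('n, 'd) conn_param \<Rightarrow> real^'m" where
    Q: "open Q" "q0 \<in> Q" "smooth_on Q a" "a q0 = b0" "\<And>q. q \<in> Q \<Longrightarrow> (q, a q) \<in> \<Omega>"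
    "\<And>q. q \<in> Q \<Longrightarrow> a q \<in> E" "smooth_on Q X" "\<And>q. q \<in> Q \<Longrightarrow> X q = 0 \<longleftrightarrow> F (q, a q) = 0"
    "rank_along X q0 T CARD('m)"
    "smooth_submanifold {q \<in> Q. X q = 0} (DIM(('n, 'd) conn_param) - CARD('m))"
  proof (rule liapunov_schmidt_reduction[OF \<open>open \<Omega>\<close> \<open>(q0, b0) \<in> \<Omega>\<close> sF F0 D E \<open>b0 \<in> E\<close> inj surj dims],
      goal_cases)
    case 1
    show ?case by (rule 1(1)) (fact 1(2-11))+
  qed
  define C where "C = {q \<in> Q. X q = 0}"
  have CQ: "C \<subseteq> Q" by (auto simp: C_def)
  define Wp where "Wp = (\<lambda>z q. phi 1 zbar \<Phi>p z (fst (fst q), snd q) (fst (a q)))"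
  define Wm where "Wm = (\<lambda>z q. phi (-1) zbar \<Phi>m z (snd (fst q), snd q) (snd (a q)))"
  have domQp: "(1 * zbar, (fst (fst q), snd q), fst (a q)) \<in> flow_domain A l Ustar 1 pp Vp r \<Phi>p"
    and domQm: "(-1 * zbar, (snd (fst q), snd q), snd (a q)) \<in> flow_domain A l Ustar (-1) pm Vm r \<Phi>m"
    if "q \<in> Q" for q
    using \<Omega>D(1,2)[OF Q(5)[OF that] Q(6)[OF that]] by (simp_all add: ip_def im_def)
  have sa: "smooth_on (S \<times> C) (\<lambda>x. a (snd x))" for S :: "real set"
    using smooth_on_compose[OF smooth_on_bounded_linear[OF bounded_linear_snd] Q(3), of "S \<times> C"] CQ by auto
  have sWp: "smooth_on (half_line 1 \<times> C) (\<lambda>(z, q). Wp z q)"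
  proof -
    let ?S = "half_line 1 \<times> C"
    let ?j = "\<lambda>x. (fst x + 1 * zbar, (fst (fst (snd x)), snd (snd x)), fst (a (snd x)))"
    have 1: "smooth_on ?S (\<lambda>x. fst x + 1 * zbar)"
      by (rule smooth_on_add[OF smooth_on_bounded_linear[OF bounded_linear_fst] smooth_on_const])
    have 2: "smooth_on ?S (\<lambda>x. (fst (fst (snd x)), snd (snd x)))"
      by (rule smooth_on_bounded_linear) (intro bounded_linear_intros)
    have 3: "smooth_on ?S (\<lambda>x. fst (a (snd x)))"
      by (rule smooth_on_linear_compose[OF bounded_linear_fst sa])
    have "smooth_on ?S ?j" by (rule smooth_on_Pair[OF 1 smooth_on_Pair[OF 2 3]])
    moreover have "?j ` ?S \<subseteq> flow_domain A l Ustar 1 pp Vp r \<Phi>p"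
      using flow_domain_half_line[OF \<Phi>p _ domQp] CQ by auto
    ultimately have "smooth_on ?S (\<lambda>x. (\<lambda>(z, q, a). \<Phi>p z q a) (?j x))"
      by (rule smooth_on_compose[OF _ half_profile_family_elims(2)[OF \<Phi>p]])
    then show ?thesis by (rule smooth_on_cong) (auto simp: Wp_def phi_def)
  qed
  have sWm: "smooth_on (half_line (-1) \<times> C) (\<lambda>(z, q). Wm z q)"
  proof -
    let ?S = "half_line (-1) \<times> C"
    let ?j = "\<lambda>x. (fst x + -1 * zbar, (snd (fst (snd x)), snd (snd x)), snd (a (snd x)))"
    have 1: "smooth_on ?S (\<lambda>x. fst x + -1 * zbar)"
      by (rule smooth_on_add[OF smooth_on_bounded_linear[OF bounded_linear_fst] smooth_on_const])
    have 2: "smooth_on ?S (\<lambda>x. (snd (fst (snd x)), snd (snd x)))"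
      by (rule smooth_on_bounded_linear) (intro bounded_linear_intros)
    have 3: "smooth_on ?S (\<lambda>x. snd (a (snd x)))"
      by (rule smooth_on_linear_compose[OF bounded_linear_snd sa])
    have "smooth_on ?S ?j" by (rule smooth_on_Pair[OF 1 smooth_on_Pair[OF 2 3]])
    moreover have "?j ` ?S \<subseteq> flow_domain A l Ustar (-1) pm Vm r \<Phi>m"
      using flow_domain_half_line[OF \<Phi>m _ domQm] CQ by auto
    ultimately have "smooth_on ?S (\<lambda>x. (\<lambda>(z, q, a). \<Phi>m z q a) (?j x))"
      by (rule smooth_on_compose[OF _ half_profile_family_elims(2)[OF \<Phi>m]])
    then show ?thesis by (rule smooth_on_cong) (auto simp: Wm_def phi_def)
  qed
  have conn: "profile_eq_on A l Ustar \<sigma> (half_line 1) (\<lambda>z. Wp z ((p1, p2), \<sigma>)) \<and>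
        profile_eq_on A l Ustar \<sigma> (half_line (-1)) (\<lambda>z. Wm z ((p1, p2), \<sigma>)) \<and>
        ((\<lambda>z. Wp z ((p1, p2), \<sigma>)) \<longlongrightarrow> p1) at_top \<and> ((\<lambda>z. Wm z ((p1, p2), \<sigma>)) \<longlongrightarrow> p2) at_bot \<and>
        Wp 0 ((p1, p2), \<sigma>) - Wm 0 ((p1, p2), \<sigma>) = 0 \<and>
        dz (half_line 1) (\<lambda>z. Wp z ((p1, p2), \<sigma>)) 0 - dz (half_line (-1)) (\<lambda>z. Wm z ((p1, p2), \<sigma>)) 0 = 0 \<and>
        \<sigma> $ l + Wp 0 ((p1, p2), \<sigma>) \<bullet> wz - w 0 \<bullet> wz = 0 \<and>
        viscous_profile A l Ustar ((p1, p2), \<sigma>) (\<lambda>z. if 0 \<le> z then Wp z ((p1, p2), \<sigma>) else Wm z ((p1, p2), \<sigma>))"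
    if qC: "((p1, p2), \<sigma>) \<in> C" for p1 p2 \<sigma>
  proof -
    let ?q = "((p1, p2), \<sigma>)"
    have qQ: "?q \<in> Q" using qC CQ by blast
    let ?wp = "\<lambda>z. Wp z ?q" and ?wm = "\<lambda>z. Wm z ?q"
    have Wp_eq: "?wp = (\<lambda>z. phi 1 zbar \<Phi>p z (p1, \<sigma>) (fst (a ?q)))"
      and Wm_eq: "?wm = (\<lambda>z. phi (-1) zbar \<Phi>m z (p2, \<sigma>) (snd (a ?q)))"
      by (simp_all add: Wp_def Wm_def)
    obtain f1 where f1: "solves A l Ustar \<sigma> {0..} ?wp f1" "f1 0 = vector_derivative ?wp (at 0)" "(?wp \<longlongrightarrow> p1) at_top"
      using flow_half_line[OF \<Phi>p _ domQp[OF qQ]] unfolding Wp_eq by (auto simp: half_line_simps)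
    obtain f2 where f2: "solves A l Ustar \<sigma> {..0} ?wm f2" "f2 0 = vector_derivative ?wm (at 0)"
        "((\<lambda>t. ?wm (- t)) \<longlongrightarrow> p2) at_top"
      using flow_half_line[OF \<Phi>m _ domQm[OF qQ]] unfolding Wm_eq by (auto simp: half_line_simps Wm_def)
    have lim2: "(?wm \<longlongrightarrow> p2) at_bot"
      using f2(3) by (simp add: filterlim_at_bot_mirror)
    have "Psi l w zbar \<Phi>p \<Phi>m (?q, a ?q) = 0"
      using \<Omega>D(3)[OF Q(5)[OF qQ] Q(6)[OF qQ]] Q(8)[OF qQ] qC by (simp add: C_def)
    moreover obtain a1 a2 where aq: "a ?q = (a1, a2)" by (cases "a ?q")
    have "Psi l w zbar \<Phi>p \<Phi>m (?q, a ?q) = (?wp 0 - ?wm 0,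
        vector_derivative ?wp (at 0) - vector_derivative ?wm (at 0), \<sigma> $ l + ?wp 0 \<bullet> wz - w 0 \<bullet> wz)"
      by (simp add: Psi_def Let_def Wp_def Wm_def aq wz_def)
    ultimately have z: "?wp 0 - ?wm 0 = 0" "vector_derivative ?wp (at 0) - vector_derivative ?wm (at 0) = 0"
      "\<sigma> $ l + ?wp 0 \<bullet> wz - w 0 \<bullet> wz = 0"
      by (simp_all only: zero_prod_def prod.inject)
    have eq: "?wp 0 = ?wm 0" "f1 0 = f2 0" using z f1(2) f2(2) by simp_all
    have dz: "dz (half_line 1) ?wp 0 = f1 0" "dz (half_line (-1)) ?wm 0 = f2 0"
      unfolding half_line_simps using at_within_half_line_nontrivial[of 0]
      by (auto intro!: solves_dz_eq[OF f1(1)] solves_dz_eq[OF f2(1)])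
    have "profile_eq_on A l Ustar \<sigma> (half_line 1) ?wp" "profile_eq_on A l Ustar \<sigma> (half_line (-1)) ?wm"
      unfolding half_line_simps using at_within_half_line_nontrivial
      by (auto intro!: solves_imp_profile_eq_on[OF f1(1)] solves_imp_profile_eq_on[OF f2(1)])
    moreover have "viscous_profile A l Ustar ?q (\<lambda>z. if 0 \<le> z then ?wp z else ?wm z)"
      by (rule glued_viscous_profile[OF smooth_A Ustar f1(1) f2(1) eq f1(3) lim2])
    ultimately show ?thesis using f1(3) lim2 z dz eq by simp
  qed
  have "q0 \<in> C" using Q(2,4) Q(8)[OF Q(2)] F0 by (simp add: C_def)
  have base: "\<forall>z\<in>half_line 1. Wp z q0 = w z" "\<forall>z\<in>half_line (-1). Wm z q0 = w z"
    using w_plus w_minus Q(4) by (auto simp: Wp_def Wm_def half_line_simps q0_def b0_def)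
  have "DIM(('n, 'd) conn_param) - CARD('m) = CARD('d) + CARD('n) - k"
    using m by simp
  then have man: "smooth_submanifold C (CARD('d) + CARD('n) - k)" using Q(10) by (simp add: C_def)
  have rank_k: "rank_along X q0 T (CARD('n) + k)" using Q(9) m by simp
  have "connection_family A l Ustar w q0 k T Q C Wp Wm X"
    unfolding connection_family_def Let_def wz_def[symmetric]
    by (intro conn conjI allI impI Q(1,2,7) CQ \<open>q0 \<in> C\<close> man sWp sWm base C_def rank_k)
  then show ?thesis unfolding q0_def by blast
qed

theorem proposition2p8:
  fixes A :: "'d::finite \<Rightarrow> real^'n \<Rightarrow> real^'n^'n"
    and l :: 'd
    and Ustar Up Um :: "(real^'n) set"
    and pp pm ap am :: "real^'n"
    and w :: "real \<Rightarrow> real^'n"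
    and k :: nat
    and Vp Vm :: "('n, 'd) end_param set"
    and \<alpha>p \<alpha>m :: "('n, 'd) end_param \<Rightarrow> real^'n \<Rightarrow> real^'n"
    and R r zbar :: real
    and \<Phi>p \<Phi>m :: "real \<Rightarrow> ('n, 'd) end_param \<Rightarrow> real^'n \<Rightarrow> real^'n"
  assumes Ustar: "open Ustar" "connected Ustar"
    and Up: "open Up" "connected Up" "Up \<subseteq> Ustar"
    and Um: "open Um" "connected Um" "Um \<subseteq> Ustar"
    and smooth_A: "\<And>j. smooth_on Ustar (A j)"
    and hyperbolic: "\<And>u \<xi> \<mu>. u \<in> Up \<union> Um \<Longrightarrow> \<xi> \<noteq> 0 \<Longrightarrow>
          is_eigenvalue (cmat (\<Sum>j\<in>UNIV. (\<xi> $ j) *\<^sub>R A j u)) \<mu> \<Longrightarrow> \<mu> \<in> \<real>"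
    and pp: "pp \<in> Up" "invertible (A l pp)"
    and pm: "pm \<in> Um" "invertible (A l pm)"
    and w: "viscous_profile A l Ustar ((pp, pm), 0) w"
    and k: "num_eigenvalues (-1) (A l pp) + num_eigenvalues 1 (A l pm) + k = CARD('n) + 1"
    and m: "CARD('m::finite) = CARD('n) + k"
    and Vp: "open Vp" "(pp, 0) \<in> Vp" "Vp \<subseteq> Ustar \<times> UNIV"
    and Vm: "open Vm" "(pm, 0) \<in> Vm" "Vm \<subseteq> Ustar \<times> UNIV"
    and \<alpha>p: "smooth_iso_family A l 1 pp Vp \<alpha>p"
    and \<alpha>m: "smooth_iso_family A l (-1) pm Vm \<alpha>m"
    and Rr: "R > 0" "r > 0"
    and \<Phi>p: "half_profile_family A l Ustar 1 pp Vp \<alpha>p R r \<Phi>p"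
    and \<Phi>m: "half_profile_family A l Ustar (-1) pm Vm \<alpha>m R r \<Phi>m"
    and zbar: "zbar \<le> 0"
    and ap: "ap \<in> E_base A l 1 pp" "norm ap < r"
    and am: "am \<in> E_base A l (-1) pm" "norm am < r"
    and w_plus: "\<And>z. z \<ge> 0 \<Longrightarrow> w z = phi 1 zbar \<Phi>p z (pp, 0) ap"
    and w_minus: "\<And>z. z \<le> 0 \<Longrightarrow> w z = phi (-1) zbar \<Phi>m z (pm, 0) am"
    and rank_a: "rank_along (Psi l w zbar \<Phi>p \<Phi>m) (((pp, pm), 0), (ap, am))
              ({0} \<times> (E_base A l 1 pp \<times> E_base A l (-1) pm)) (CARD('n) + 1 - k)"
  shows "(rank_along (Psi l w zbar \<Phi>p \<Phi>m) (((pp, pm), 0), (ap, am))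
              (dirs_p \<times> (E_base A l 1 pp \<times> E_base A l (-1) pm)) (2 * CARD('n) + 1) \<longrightarrow>
           (\<exists>Q C Wp Wm. \<exists>X :: ('n, 'd) conn_param \<Rightarrow> real^'m.
              connection_family A l Ustar w ((pp, pm), 0) k dirs_p Q C Wp Wm X)) \<and>
         (rank_along (Psi l w zbar \<Phi>p \<Phi>m) (((pp, pm), 0), (ap, am))
              (dirs_ps l \<times> (E_base A l 1 pp \<times> E_base A l (-1) pm)) (2 * CARD('n) + 1) \<longrightarrow>
           (\<exists>Q C Wp Wm. \<exists>X :: ('n, 'd) conn_param \<Rightarrow> real^'m.
              connection_family A l Ustar w ((pp, pm), 0) k (dirs_ps l) Q C Wp Wm X))"
proof -
  have real: "dim (E_base A l 1 pp) \<le> num_eigenvalues (-1) (A l pp)" "dim (E_base A l (-1) pm) \<le> num_eigenvalues 1 (A l pm)"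
    using dim_E_base_le[of A pp l 1] dim_E_base_le[of A pm l "-1"] hyperbolic pp(1) pm(1) by auto
  have dimE: "dim (E_base A l 1 pp) + dim (E_base A l (-1) pm) + k \<le> CARD('n) + 1"
    using real k by linarith
  note family = connection_family_exists[OF Ustar(1) smooth_A w Vp(1,2) Vm(1,2) \<Phi>p \<Phi>m zbar ap am
      w_plus w_minus dimE m rank_a]
  have "subspace (dirs_p :: ('n, 'd) conn_param set)" "subspace (dirs_ps l :: ('n, 'd) conn_param set)"
    unfolding dirs_p_def dirs_ps_def by (simp_all add: subspace_Times)
  then show ?thesis using family by blast
qed

end
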